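(* Let $k$ be a field, let $\vec r=(r_1,\dots,r_m)$ be a vector of positive integers, put $n=\sum_{i=1}^m r_i$, and let $1\le d\le n$. Then the rank $d$ discrete polymatroids on the multiset $[\vec r]$ are in bijection (via $B\mapsto \operatorname{Conv}(B)\subseteq\mathbb{R}^m$) with the subpolytopes of $\lambda_{\vec r}(\Delta(d,n))\subseteq\mathbb{R}^m$ whose vertices and edges are among the images under $\lambda_{\vec r}$ of the vertices and edges of the hypersimplex $\Delta(d,n)$. Moreover, this bijection identifies the discrete polymatroids representable over $k$ with the lattice polytopes corresponding to $S$-orbit closures in $\operatorname{Gr}(d,n)$.
   Context: $[\vec r]$ is the multiset with underlying set $\{1,\dots,m\}$ in which $i$ has multiplicity $r_i$; sub-multisets of $[\vec r]$ are identified with vectors $v\in\mathbb{Z}_{\ge0}^m$ with $v_i\le r_i$ for all $i$. A rank $d$ discrete polymatroid on $[\vec r]$ is a nonempty set $B$ of vectors $v\in\mathbb{Z}_{\ge 0}^m$ with $v_i\le r_i$ for all $i$ and $\sum_i v_i=d$, satisfying the exchange property: if $u,v\in B$ and $u_i>v_i$ for some $i$, then there is $j$ with $u_j<v_j$ and $u-e_i+e_j\in B$. The hypersimplex is $\Delta(d,n)=\{(a_1,\dots,a_n)\in\mathbb{R}^n : a_i\in[0,1],\ \sum a_i=d\}$; its vertices are the vectors $e_I=\sum_{i\in I}e_i$ for $d$-element subsets $I\subseteq[n]=\{1,\dots,n\}$. Let $\pi_{\vec r}:[n]\to[m]$ send the first $r_1$ elements to $1$, the next $r_2$ elements to $2$,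 and so on. The linear map $\lambda_{\vec r}:\mathbb{R}^n\to\mathbb{R}^m$ is defined by $\lambda_{\vec r}(e_j)=e_{\pi_{\vec r}(j)}$. The image under $\lambda_{\vec r}$ of a vertex of $\Delta(d,n)$ need not be a vertex of $\lambda_{\vec r}(\Delta(d,n))$, and the subpolytopes in the claim are allowed to use such points as vertices. $\operatorname{Gr}(d,n)$ is the Grassmannian of $d$-dimensional subspaces of $k^n$, in its Plücker embedding in $\mathbb{P}^{\binom nd-1}$ with coordinates $x_I$. The torus $T=(k^\times)^n$ acts by scaling the coordinates of $k^n$, and $S=\{(t_1,\dots,t_1,t_2,\dots,t_2,\dots,t_m,\dots,t_m) : t_i\in k^\times\}\subseteq T$, with $t_i$ repeated $r_i$ times, is the diagonal subtorus. For a $k$-point $L$ of $\operatorname{Gr}(d,n)$, the lattice polytope corresponding to the orbit closure $\overline{S\cdot L}\subseteq\mathbb{P}^{\binom nd-1}$ (a projective toric variety) is the convex hull in $\mathbb{R}^m$ of the $S$-weights $\lambda_{\vec r}(e_I)$ over all $I$ with $x_I(L)\ne0$. Representability: a $k$-point $L$ of $\operatorname{Gr}(d,n)$ represents the matroid $M(L)$ on $[n]$ with bases $\{I : x_I(L)\neq 0\}$, and it represents the discrete polymatroid $\pi_{\vec r}(M(L))=\{\lambda_{\vec r}(e_I) : I \text{ a basis of } M(L)\}$ on $[\vec r]$. A rank $d$ discrete polymatroid on $[\vec r]$ is representable over $k$ if it is represented in this sense by some $k$-point $L$ of $\operatorname{Gr}(d,n)$.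
   Formalization: "Edges among the images" is read as: each edge of the subpolytope is a union of images of edges of the hypersimplex. With single images the claim fails for r=(2,2), d=2, B={(2,0),(1,1),(0,2)}. Subpolytopes are taken nonempty. *)

theory Defs
  imports "HOL-Analysis.Analysis" "Jordan_Normal_Form.Determinant"
begin

text \<open>
  \<open>Jordan_Normal_Form\<close> supplies determinants of matrices whose size is a natural number; the
  vectors below are all those of \<open>HOL-Analysis\<close>.
\<close>

no_notation Matrix.vec_index (infixl \<open>$\<close> 100)
no_notation Matrix.scalar_prod (infix \<open>\<bullet>\<close> 70)
hide_const (open) Matrix.vec

text \<open>
  \<open>[m]\<close> and \<open>[n]\<close> are finite linearly ordered types \<open>'m\<close> and \<open>'n\<close>, with \<open>CARD('n) = (\<Sum>i. r i)\<close>.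
  Lattice points are real vectors with coordinates in \<open>\<nat>\<close>.
\<close>

definition discrete_polymatroid ::
  "('m::finite \<Rightarrow> nat) \<Rightarrow> nat \<Rightarrow> (real ^ 'm) set \<Rightarrow> bool" where
  "discrete_polymatroid r d B \<longleftrightarrow>
     B \<noteq> {} \<and>
     (\<forall>v\<in>B. (\<forall>i. v $ i \<in> \<nat> \<and> v $ i \<le> real (r i)) \<and> (\<Sum>i\<in>UNIV. v $ i) = real d) \<and>
     (\<forall>u\<in>B. \<forall>v\<in>B. \<forall>i. u $ i > v $ i \<longrightarrow>
        (\<exists>j. u $ j < v $ j \<and> u - axis i 1 + axis j 1 \<in> B))"

definition hypersimplex :: "nat \<Rightarrow> (real ^ 'n::finite) set" where
  "hypersimplex d = {a. (\<forall>j. a $ j \<in> {0..1}) \<and> (\<Sum>j\<in>UNIV. a $ j) = real d}"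

definition indicator_vec :: "'n set \<Rightarrow> real ^ 'n::finite" where
  "indicator_vec I = (\<Sum>j\<in>I. axis j 1)"

text \<open>
  The map \<open>\<pi>\<^sub>r\<close>: an element \<open>j\<close> with \<open>p\<close> predecessors lies in the first block \<open>i\<close> for which
  the blocks up to and including \<open>i\<close> have more than \<open>p\<close> elements in total.
\<close>

definition block :: "('m::{finite,linorder} \<Rightarrow> nat) \<Rightarrow> 'n::{finite,linorder} \<Rightarrow> 'm" where
  "block r j = Min {i. card {..<j} < (\<Sum>i'\<in>{..i}. r i')}"

definition block_sum ::
  "('m::{finite,linorder} \<Rightarrow> nat) \<Rightarrow> real ^ 'n::{finite,linorder} \<Rightarrow> real ^ 'm::{finite,linorder}" where
  "block_sum r a = (\<Sum>j\<in>UNIV. a $ j *\<^sub>R axis (block r j) 1)"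

text \<open>
  \<open>P\<close> is a nonempty subpolytope of \<open>f ` Q\<close> whose vertices and edges are among the images of those
  of \<open>Q\<close>. An edge of \<open>P\<close> may pass through images of vertices of \<open>Q\<close> and is then read as being
  subdivided there, so it is required to be a union of images of edges rather than a single one.
  Asking for a single one would exclude polytopes that come from discrete polymatroids: for
  \<open>r = (2,2)\<close> and \<open>d = 2\<close>, the set \<open>{(2,0), (1,1), (0,2)}\<close> is a discrete polymatroid whose hull is
  an edge of twice the length of the image of any edge of the hypersimplex.
\<close>

definition subpolytope_of_image ::
  "('a::euclidean_space \<Rightarrow> 'b::euclidean_space) \<Rightarrow> 'a set \<Rightarrow> 'b set \<Rightarrow> bool" where
  "subpolytope_of_image f Q P \<longleftrightarrow>
     polytope P \<and> P \<noteq> {} \<and> P \<subseteq> f ` Q \<and>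
     (\<forall>v. v extreme_point_of P \<longrightarrow> v \<in> f ` {w. w extreme_point_of Q}) \<and>
     (\<forall>E. E edge_of P \<longrightarrow> (\<exists>\<E>. \<E> \<subseteq> {f ` F |F. F edge_of Q} \<and> E = \<Union>\<E>))"

definition grassmannian :: "nat \<Rightarrow> ('k::field ^ 'n::finite) set set" where
  "grassmannian d = {L. vec.subspace L \<and> vec.dim L = d}"

definition ordered_basis :: "('k::field ^ 'n::finite) set \<Rightarrow> ('k ^ 'n::finite) list" where
  "ordered_basis L = (SOME bs. distinct bs \<and> vec.independent (set bs) \<and> vec.span (set bs) = L)"

text \<open>The maximal minor, on the columns in \<open>I\<close>, of the matrix with the vectors \<open>bs\<close> as rows.\<close>

definition minor :: "nat \<Rightarrow> ('k::field ^ 'n::{finite,linorder}) list \<Rightarrow> 'n set \<Rightarrow> 'k" where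
  "minor d bs I = Determinant.det (mat d d (\<lambda>(a, b). (bs ! a) $ (sorted_list_of_set I ! b)))"

text \<open>
  The homogeneous coordinate \<open>x\<^sub>I(L)\<close>. The chosen basis of \<open>L\<close> only affects the common scalar factor
  of the coordinates (see \<open>minor_change_basis\<close>), and only their vanishing is used below.
\<close>

definition plucker :: "nat \<Rightarrow> ('k::field ^ 'n::{finite,linorder}) set \<Rightarrow> 'n set \<Rightarrow> 'k" where
  "plucker d L I = minor d (ordered_basis L) I"

definition matroid_bases :: "nat \<Rightarrow> ('k::field ^ 'n::{finite,linorder}) set \<Rightarrow> 'n set set" where
  "matroid_bases d L = {I. card I = d \<and> plucker d L I \<noteq> 0}"

definition represented_polymatroid ::
  "('m::{finite,linorder} \<Rightarrow> nat) \<Rightarrow> nat \<Rightarrow> ('k::field ^ 'n::{finite,linorder}) set \<Rightarrow> (real ^ 'm::{finite,linorder}) set"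
  where
  "represented_polymatroid r d L = {block_sum r (indicator_vec I) |I. I \<in> matroid_bases d L}"

text \<open>
  The diagonal subtorus \<open>S\<close> consists of the \<open>s\<close> with \<open>s\<^sub>j = t (block r j)\<close>, for \<open>t\<close> with nonzero
  entries. It scales the Pluecker coordinate \<open>x\<^sub>I\<close> by the monomial in \<open>t\<close> whose exponent vector is
  the weight \<open>block_sum r (indicator_vec I)\<close>; see \<open>minor_torus_act\<close>.
\<close>

definition torus_act ::
  "('m::{finite,linorder} \<Rightarrow> nat) \<Rightarrow> ('m \<Rightarrow> 'k::field) \<Rightarrow> 'k ^ 'n::{finite,linorder} \<Rightarrow> 'k ^ 'n::{finite,linorder}" where
  "torus_act r t x = (\<chi> j. t (block r j) * x $ j)"

definition weight ::
  "('m::{finite,linorder} \<Rightarrow> nat) \<Rightarrow> 'n::{finite,linorder} set \<Rightarrow> real ^ 'm::{finite,linorder}" where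
  "weight r I = block_sum r (indicator_vec I)"

text \<open>The lattice polytope of the projective toric variety that is the closure of \<open>S \<cdot> L\<close>.\<close>

definition orbit_closure_polytope ::
  "('m::{finite,linorder} \<Rightarrow> nat) \<Rightarrow> nat \<Rightarrow> ('k::field ^ 'n::{finite,linorder}) set \<Rightarrow> (real ^ 'm::{finite,linorder}) set"
  where
  "orbit_closure_polytope r d L = convex hull {weight r I |I. card I = d \<and> plucker d L I \<noteq> 0}"

lemma ordered_basis:
  fixes L :: "('k::field ^ 'n::finite) set"
  assumes "L \<in> grassmannian d"
  shows "vec.independent (set (ordered_basis L))" "vec.span (set (ordered_basis L)) = L"
    "distinct (ordered_basis L)" "length (ordered_basis L) = d"
proof -
  from assms have L: "vec.subspace L" "vec.dim L = d" by (auto simp: grassmannian_def)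
  obtain S where S: "vec.independent S" "S \<subseteq> L" "L \<subseteq> vec.span S"
    using vec.basis_exists[of L] by metis
  from S L have span: "vec.span S = L"
    by (metis vec.span_eq_iff vec.span_mono subset_antisym)
  obtain bs where "set bs = S" "distinct bs"
    using finite_distinct_list[OF vec.finiteI_independent[OF S(1)]] by blast
  then have "\<exists>bs. distinct bs \<and> vec.independent (set bs) \<and> vec.span (set bs) = L"
    using S span by blast
  from someI_ex[OF this] show
    *: "vec.independent (set (ordered_basis L))" "vec.span (set (ordered_basis L)) = L"
      "distinct (ordered_basis L)"
    unfolding ordered_basis_def by blast+
  then show "length (ordered_basis L) = d"
    using L by (metis distinct_card vec.dim_span_eq_card_independent)
qed

lemma minor_change_basis:
  fixes bs cs :: "('k::field ^ 'n::{finite,linorder}) list"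
  assumes "length bs = d" "distinct bs" "length cs = d" "set cs \<subseteq> vec.span (set bs)"
  obtains c where "\<And>I. minor d cs I = c * minor d bs I"
proof -
  have "\<forall>a. \<exists>u. a < d \<longrightarrow> cs ! a = (\<Sum>v\<in>set bs. u v *s v)"
    using assms by (force simp: vec.span_finite subset_iff set_conv_nth)
  then obtain u where u: "\<And>a. a < d \<Longrightarrow> cs ! a = (\<Sum>v\<in>set bs. u a v *s v)" by metis
  have cs: "cs ! a = (\<Sum>l\<in>{0..<d}. u a (bs ! l) *s (bs ! l))" if "a < d" for a
    using sum.reindex_bij_betw[OF bij_betw_nth[OF assms(2), of "{..<d}" "set bs"],
        of "\<lambda>v. u a v *s v"] assms(1) u[OF that] by (simp add: lessThan_atLeast0)
  define C where "C = mat d d (\<lambda>(a, l). u a (bs ! l))"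
  show thesis
  proof
    fix I :: "'n set"
    let ?M = "\<lambda>bs. mat d d (\<lambda>(a, b). (bs ! a) $ (sorted_list_of_set I ! b))"
    have "?M cs = C * ?M bs"
      by (rule eq_matI) (auto simp: C_def cs scalar_prod_def sum_component)
    then show "minor d cs I = Determinant.det C * minor d bs I"
      unfolding minor_def by (metis C_def det_mult mat_carrier)
  qed
qed

lemma indicator_vec_nth: "indicator_vec I $ j = (if j \<in> I then 1 else 0)"
proof -
  have "indicator_vec I $ j = (\<Sum>l\<in>I. if l = j then 1 else 0)"
    unfolding indicator_vec_def sum_component by (rule sum.cong) (auto simp: axis_def)
  then show ?thesis by simp
qed

lemma weight_nth: "weight r I $ i = real (card {j\<in>I. block r j = i})"
proof -
  have "weight r I $ i = (\<Sum>j\<in>UNIV. if j \<in> {j\<in>I. block r j = i} then 1 else 0)"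
    unfolding weight_def block_sum_def sum_component
    by (rule sum.cong) (auto simp: axis_def indicator_vec_nth)
  also have "\<dots> = real (card {j\<in>I. block r j = i})"
    by (subst sum.inter_restrict[symmetric]) auto
  finally show ?thesis .
qed

lemma minor_torus_act:
  fixes t :: "'m::{finite,linorder} \<Rightarrow> 'k::field" and bs :: "('k ^ 'n::{finite,linorder}) list"
  assumes "length bs = d" and "card I = d"
  shows "minor d (map (torus_act r t) bs) I =
           (\<Prod>i\<in>UNIV. t i ^ nat \<lfloor>weight r I $ i\<rfloor>) * minor d bs I"
proof -
  let ?c = "\<lambda>b. t (block r (sorted_list_of_set I ! b))"
  have len: "length (sorted_list_of_set I) = d" using assms by simp
  have bij: "bij_betw (\<lambda>b. sorted_list_of_set I ! b) {0..<d} I"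
    by (rule bij_betw_nth) (use len in auto)
  have "(\<Prod>b\<in>{0..<d}. ?c b) = (\<Prod>j\<in>I. t (block r j))"
    by (rule prod.reindex_bij_betw[OF bij, of "\<lambda>j. t (block r j)"])
  also have "\<dots> = (\<Prod>i\<in>UNIV. \<Prod>j\<in>{j\<in>I. block r j = i}. t (block r j))"
    by (rule prod.group[symmetric]) auto
  also have "\<dots> = (\<Prod>i\<in>UNIV. t i ^ nat \<lfloor>weight r I $ i\<rfloor>)"
    by (rule prod.cong) (auto simp: weight_nth)
  finally have c: "(\<Prod>b\<in>{0..<d}. ?c b) = (\<Prod>i\<in>UNIV. t i ^ nat \<lfloor>weight r I $ i\<rfloor>)" .
  have perm: "(\<Prod>a\<in>{0..<d}. ?c (p a)) = (\<Prod>b\<in>{0..<d}. ?c b)" if "p permutes {0..<d}" for p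
    by (rule prod.reindex_bij_betw[OF permutes_imp_bij[OF that], of ?c])
  have "minor d (map (torus_act r t) bs) I = (\<Prod>b\<in>{0..<d}. ?c b) * minor d bs I"
    unfolding minor_def Determinant.det_def' [OF mat_carrier] sum_distrib_left
  proof (rule sum.cong, goal_cases)
    case (2 p)
    then have p: "p permutes {0..<d}" by simp
    have lt: "p a < d" if "a < d" for a
      using permutes_in_image[OF p, of a] that by simp
    show ?case
      by (simp add: perm[OF p, symmetric] lt assms torus_act_def prod.distrib mult_ac)
  qed simp
  then show ?thesis by (simp add: c)
qed

end

theory Submission
  imports Defs
begin

text \<open>
  For a discrete polymatroid \<open>B\<close> and a vector \<open>y \<in> B\<close>, the relation
  \<open>y - e\<^sub>i + e\<^sub>j \<in> B\<close> is transitive, and a sum of coordinates \<open>x(D)\<close> that no such exchange at \<open>y\<close>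
  decreases is minimal on \<open>B\<close> at \<open>y\<close>. Taking for \<open>D\<close> what is reachable from the coordinates where \<open>y\<close>
  exceeds a lattice point \<open>u\<close> of the hull, with \<open>y\<close> nearest to \<open>u\<close>, shows that \<open>u \<in> B\<close>; so \<open>B\<close> is
  recovered from its hull. Conversely, let \<open>P\<close> be a polytope with integral vertices and edges in
  directions \<open>e\<^sub>j - e\<^sub>i\<close>. By the argument behind the simplex method, a point \<open>w\<close> of \<open>P\<close> minimises
  \<open>x(R)\<close> as soon as no feasible direction \<open>e\<^sub>j - e\<^sub>i\<close> at \<open>w\<close> leaves \<open>R\<close>. With \<open>R\<close> the set reachable
  from \<open>i\<close> this yields a feasible exchange direction at a lattice point, and it yields integrality
  of the step length, because the minimum of \<open>x(R)\<close> over \<open>P\<close> is attained at a vertex.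
  The hypersimplex is the case of the uniform matroid. For the second part, the bases of a subspace
  are the minimal sets of coordinates on which no nonzero vector of the subspace vanishes.
\<close>

section \<open>Edges of polytopes\<close>


text \<open>An inclusion-minimal face containing \<open>q\<close> works: the relative boundary of a
  polyhedron is the union of its facets, so a \<open>q\<close> on it would lie in a smaller
  face.\<close>

lemma mem_rel_interior_some_face:
  fixes P :: "'a::euclidean_space set"
  assumes "polytope P" "q \<in> P"
  obtains F where "F face_of P" "q \<in> rel_interior F"
proof -
  have "finite {F. F face_of P \<and> q \<in> F}"
    by (rule finite_subset[OF _ finite_polytope_faces[OF assms(1)]]) auto
  moreover have "P \<in> {F. F face_of P \<and> q \<in> F}"
    using assms face_of_refl polytope_imp_convex by auto
  ultimately obtain F where F: "F face_of P" "q \<in> F"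
    and min: "\<And>G. G face_of P \<Longrightarrow> q \<in> G \<Longrightarrow> \<not> G \<subset> F"
    using finite_has_minimal[of "{F. F face_of P \<and> q \<in> F}"] by blast
  have "polyhedron F"
    using F assms(1) face_of_polytope_polytope polytope_imp_polyhedron by blast
  have "q \<in> rel_interior F"
  proof (rule ccontr)
    assume "q \<notin> rel_interior F"
    then have "q \<in> \<Union>{G. G facet_of F}"
      using F(2) rel_boundary_of_polyhedron[OF \<open>polyhedron F\<close>] by auto
    then obtain G where "G facet_of F" "q \<in> G" by blast
    then have "G face_of P" "G \<subset> F"
      using F(1) face_of_trans facet_of_imp_face_of facet_of_imp_subset
        facet_of_irrefl by blast+
    then show False using min \<open>q \<in> G\<close> by blast
  qed
  then show thesis using that F by blast
qed

lemma edge_of_polytope_segment: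
  assumes "polytope P" "E edge_of P"
  obtains a b where "E = closed_segment a b" "a \<noteq> b" "a extreme_point_of P" "b extreme_point_of P"
proof -
  have E: "E face_of P" "aff_dim E = 1" using assms(2) by (auto simp: edge_of_def)
  have "polytope E" using E(1) assms(1) face_of_polytope_polytope by blast
  moreover have "E \<noteq> {}" "collinear E" using E(2) by (auto simp: collinear_aff_dim)
  ultimately obtain a b where ab: "E = closed_segment a b"
    using compact_convex_collinear_segment polytope_imp_compact polytope_imp_convex by metis
  then have "a \<noteq> b" using E(2) by auto
  moreover have "a extreme_point_of P" "b extreme_point_of P"
    using extreme_point_of_face[OF E(1)] unfolding ab extreme_point_of_segment by blast+
  ultimately show thesis using that ab by blast
qed

text \<open>The slice of \<open>P\<close> by a hyperplane that separates \<open>w\<close> from the other vertices has a vertex on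
  which \<open>c\<close> is smaller than at \<open>w\<close>, and every vertex of the slice lies on an edge of \<open>P\<close> at \<open>w\<close>.\<close>

lemma improving_edge:
  fixes P :: "'a::euclidean_space set"
  assumes P: "polytope P" and w: "w extreme_point_of P" and z: "z \<in> P" "c \<bullet> z < c \<bullet> w"
  obtains b where "closed_segment w b edge_of P" "c \<bullet> b < c \<bullet> w"
proof -
  define V where "V = {v. v extreme_point_of P}"
  have finV: "finite V"
    unfolding V_def using P polytope_imp_polyhedron finite_polyhedron_extreme_points by blast
  have "{w} exposed_face_of P"
    using exposed_face_of_polyhedron P polytope_imp_polyhedron w face_of_singleton by blast
  then obtain a \<beta> where a: "P \<subseteq> {x. a \<bullet> x \<le> \<beta>}" "{w} = P \<inter> {x. a \<bullet> x = \<beta>}"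
    unfolding exposed_face_of_def by blast
  have awl: "a \<bullet> w = \<beta>" using a(2) by auto
  have lt: "a \<bullet> x < \<beta>" if "x \<in> P" "x \<noteq> w" for x
    using a that by (metis (mono_tags, lifting) Int_iff insertE empty_iff mem_Collect_eq order_le_less subsetD)
  \<comment> \<open>Including \<open>z\<close> in the maximum makes the hyperplane
    \<open>a \<bullet> x = \<gamma>\<close> separate \<open>w\<close> from \<open>z\<close> as well
    as from the other vertices, so the segment from \<open>w\<close> to \<open>z\<close> crosses
    it.\<close>
  define M where "M = Max ((\<bullet>) a ` insert z (V - {w}))"
  have "M < \<beta>"
    unfolding M_def using finV lt z by (subst Max_less_iff) (auto simp: V_def extreme_point_of_def)
  then obtain \<gamma> where \<gamma>: "M < \<gamma>" "\<gamma> < \<beta>" using dense by blast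
  have le_M: "a \<bullet> x \<le> M" if "x \<in> insert z (V - {w})" for x
    unfolding M_def using finV that by (intro Max_ge) auto
  have Vlt: "a \<bullet> v < \<gamma>" if "v \<in> V" "v \<noteq> w" for v
    using le_M[of v] that \<gamma> by auto
  have az: "a \<bullet> z < \<gamma>" using le_M[of z] \<gamma> by auto
  define Q where "Q = P \<inter> {x. a \<bullet> x = \<gamma>}"
  have "compact P" "convex P" using P polytope_imp_compact polytope_imp_convex by blast+
  then have Q: "compact Q" "convex Q"
    unfolding Q_def by (auto simp: compact_Int_closed closed_hyperplane convex_Int convex_hyperplane)
  \<comment> \<open>The parameter at which the segment from \<open>w\<close> to \<open>z\<close>
    meets the hyperplane.\<close>
  define t where "t = (\<beta> - \<gamma>) / (\<beta> - a \<bullet> z)"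
  have t: "0 < t" "t \<le> 1" using \<gamma> az by (auto simp: t_def field_simps)
  define q0 where "q0 = (1 - t) *\<^sub>R w + t *\<^sub>R z"
  have "q0 \<in> P"
    unfolding q0_def using w z(1) P t polytope_imp_convex
    by (intro convexD_alt) (auto simp: extreme_point_of_def)
  moreover have "a \<bullet> q0 = \<beta> - t * (\<beta> - a \<bullet> z)"
    by (simp add: q0_def inner_add_right awl algebra_simps)
  then have "a \<bullet> q0 = \<gamma>" using \<gamma> az by (simp add: t_def)
  ultimately have q0Q: "q0 \<in> Q" by (simp add: Q_def)
  have "c \<bullet> q0 = c \<bullet> w - t * (c \<bullet> w - c \<bullet> z)"
    by (simp add: q0_def inner_add_right algebra_simps)
  then have cq0: "c \<bullet> q0 < c \<bullet> w" using t z by simp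
  obtain q1 where q1: "q1 \<in> Q" "\<And>x. x \<in> Q \<Longrightarrow> c \<bullet> q1 \<le> c \<bullet> x"
    using continuous_attains_inf[OF Q(1) _ continuous_on_inner[OF continuous_on_const continuous_on_id]]
      q0Q by blast
  \<comment> \<open>The minimum of \<open>c\<close> over \<open>Q\<close> is at most its value at
    \<open>q0\<close>, and a vertex of the minimising face \<open>S\<close> is also a vertex of
    \<open>Q\<close>.\<close>
  define S where "S = Q \<inter> {x. c \<bullet> x = c \<bullet> q1}"
  have S: "S face_of Q"
    unfolding S_def using q1 Q(2) by (intro face_of_Int_supporting_hyperplane_ge) auto
  have "compact S" "convex S" "S \<noteq> {}"
    using S Q q1 face_of_imp_compact face_of_imp_convex by (auto simp: S_def)
  then obtain q where "q extreme_point_of S" using extreme_point_exists_convex by blast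
  then have q: "q extreme_point_of Q" "q \<in> S" using S extreme_point_of_face by blast+
  then have cq: "c \<bullet> q < c \<bullet> w" using q1(2)[OF q0Q] cq0 by (auto simp: S_def)
  have qP: "q \<in> P" and aq: "a \<bullet> q = \<gamma>" using q(2) by (auto simp: S_def Q_def)
  obtain F where F: "F face_of P" "q \<in> rel_interior F"
    using mem_rel_interior_some_face[OF P qP] by blast
  have qF: "q \<in> F" using F(2) rel_interior_subset by blast
  \<comment> \<open>In dimension 2 or more the hyperplane would cut the affine hull of
    \<open>F\<close> in at least a line through \<open>q\<close>. Moving \<open>q\<close> both ways
    along it inside \<open>F\<close> contradicts that \<open>q\<close> is a vertex of
    \<open>Q\<close>.\<close>
  have "aff_dim F \<le> 1"
  proof (rule ccontr)
    assume "\<not> aff_dim F \<le> 1"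
    moreover have "q \<in> affine hull F \<inter> {x. a \<bullet> x = \<gamma>}" using qF aq by (simp add: hull_inc)
    ultimately have "aff_dim (affine hull F \<inter> {x. a \<bullet> x = \<gamma>}) \<ge> 1"
      using aff_dim_affine_Int_hyperplane[of "affine hull F" a \<gamma>]
      by (auto simp: aff_dim_affine_hull affine_affine_hull split: if_splits)
    then have "\<not> affine hull F \<inter> {x. a \<bullet> x = \<gamma>} \<subseteq> {q}"
      using aff_dim_subset aff_dim_sing by (metis not_one_le_zero order_trans)
    then obtain p where p: "p \<in> affine hull F" "a \<bullet> p = \<gamma>" "p \<noteq> q" by blast
    obtain e where e: "e > 0" "ball q e \<inter> affine hull F \<subseteq> F"
      using F(2) by (auto simp: mem_rel_interior_ball)
    define s where "s = e / (2 * norm (p - q))"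
    have s: "s > 0" using e p by (simp add: s_def)
    have inF: "q + s' *\<^sub>R (p - q) \<in> F" if "\<bar>s'\<bar> = s" for s'
    proof -
      have "q + s' *\<^sub>R (p - q) = (1 - s') *\<^sub>R q + s' *\<^sub>R p" by (simp add: algebra_simps)
      then have "q + s' *\<^sub>R (p - q) \<in> affine hull F"
        using mem_affine[OF affine_affine_hull, of q F p "1 - s'" s'] qF p by (simp add: hull_inc)
      moreover have "dist q (q + s' *\<^sub>R (p - q)) = e / 2"
        using that p by (simp add: dist_norm s_def)
      ultimately show ?thesis using e by auto
    qed
    have inQ: "q + s' *\<^sub>R (p - q) \<in> Q" if "\<bar>s'\<bar> = s" for s'
      using inF[OF that] F(1) face_of_imp_subset p aq
      by (auto simp: Q_def inner_add_right inner_diff_right)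
    have "q = midpoint (q + s *\<^sub>R (p - q)) (q + (- s) *\<^sub>R (p - q))"
      by (simp add: midpoint_def)
    moreover have "q + s *\<^sub>R (p - q) \<noteq> q + (- s) *\<^sub>R (p - q)"
    proof -
      have "q + s *\<^sub>R x - (q + (- s) *\<^sub>R x) = (2 * s) *\<^sub>R x" for x
        by (simp add: scaleR_2 flip: scaleR_scaleR)
      then show ?thesis using s p by (metis mult_pos_pos zero_less_numeral eq_iff_diff_eq_0 less_irrefl scaleR_eq_0_iff)
    qed
    ultimately have "q \<in> open_segment (q + s *\<^sub>R (p - q)) (q + (- s) *\<^sub>R (p - q))"
      by (metis midpoint_in_open_segment)
    then show False using q(1) inQ[of s] inQ[of "- s"] s unfolding extreme_point_of_def by auto
  qed
  \<comment> \<open>No vertex of \<open>P\<close> lies on the hyperplane: \<open>a\<close> has the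
    value \<open>\<beta> > \<gamma>\<close> at \<open>w\<close> and values below
    \<open>\<gamma>\<close> at the others.\<close>
  moreover have "aff_dim F \<noteq> 0"
  proof
    assume "aff_dim F = 0"
    then obtain x where "F = {x}" using aff_dim_eq_0 by blast
    then have "q \<in> V" using F(1) qF by (simp add: V_def face_of_singleton)
    then show False using Vlt[of q] aq awl \<gamma> by auto
  qed
  moreover have "aff_dim F \<noteq> -1" using qF by (metis aff_dim_empty empty_iff)
  moreover have "aff_dim F \<ge> -1" by (rule aff_dim_geq)
  ultimately have edge: "F edge_of P" using F(1) by (simp add: edge_of_def)
  obtain x y where xy: "F = closed_segment x y" "x \<noteq> y" "x \<in> V" "y \<in> V"
    using edge_of_polytope_segment[OF P edge] by (auto simp: V_def)
  obtain \<mu> where \<mu>: "0 \<le> \<mu>" "\<mu> \<le> 1" "q = (1 - \<mu>) *\<^sub>R x + \<mu> *\<^sub>R y"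
    using qF xy(1) by (auto simp: closed_segment_def)
  have "x = w \<or> y = w"
  proof (rule ccontr)
    assume "\<not> (x = w \<or> y = w)"
    then have "a \<bullet> x < \<gamma>" "a \<bullet> y < \<gamma>" using Vlt xy by auto
    then have "F \<subseteq> {x. a \<bullet> x < \<gamma>}"
      unfolding xy(1) by (intro closed_segment_subset convex_halfspace_lt) auto
    then show False using qF aq by auto
  qed
  then obtain b where b: "F = closed_segment w b"
    using xy(1) by (auto simp: closed_segment_commute)
  have "c \<bullet> b < c \<bullet> w"
  proof (rule ccontr)
    assume "\<not> c \<bullet> b < c \<bullet> w"
    then have "F \<subseteq> {x. c \<bullet> x \<ge> c \<bullet> w}"
      unfolding b by (intro closed_segment_subset convex_halfspace_ge) auto
    then show False using qF cq by auto
  qed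
  then show thesis using that edge b by blast
qed

section \<open>Discrete polymatroids and their hulls\<close>


lemma inner_indicator_vec: "indicator_vec D \<bullet> x = (\<Sum>k\<in>D. x $ k)"
proof -
  have "indicator_vec D \<bullet> x = (\<Sum>k\<in>UNIV. if k \<in> D then x $ k else 0)"
    unfolding inner_vec_def by (rule sum.cong) (auto simp: indicator_vec_nth)
  then show ?thesis by (simp add: sum.If_cases)
qed

lemma inner_indicator_vec_axis: "indicator_vec D \<bullet> axis i 1 = (if i \<in> D then 1 else 0)"
  by (simp add: inner_axis indicator_vec_nth)

context
  fixes r :: "'m::finite \<Rightarrow> nat" and d :: nat and B :: "(real ^ 'm) set"
  assumes B: "discrete_polymatroid r d B"
begin

lemma polymatroid_nth: 
  assumes "v \<in> B" shows "v $ i \<in> \<nat>" "0 \<le> v $ i" "v $ i \<le> real (r i)" "(\<Sum>i\<in>UNIV. v $ i) = real d"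
proof -
  show "v $ i \<in> \<nat>" "v $ i \<le> real (r i)" "(\<Sum>i\<in>UNIV. v $ i) = real d"
    using B assms unfolding discrete_polymatroid_def by blast+
  then show "0 \<le> v $ i" by (auto elim!: Nats_cases)
qed

lemma polymatroid_exchange:
  assumes "u \<in> B" "v \<in> B" "u $ i > v $ i"
  obtains j where "u $ j < v $ j" "u - axis i 1 + axis j 1 \<in> B"
  using B assms unfolding discrete_polymatroid_def by blast

lemma finite_polymatroid: "finite B"
proof (rule finite_subset)
  let ?S = "{v. \<forall>i. v $ i \<in> real ` {..r i}}"
  show "B \<subseteq> ?S"
  proof (safe, goal_cases)
    case (1 v i)
    then show ?case using polymatroid_nth(1,3)[of v i] by (auto elim!: Nats_cases)
  qed
  have "finite (PiE UNIV (\<lambda>i. real ` {..r i}))" by (intro finite_PiE) auto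
  moreover have "?S \<subseteq> vec_lambda ` PiE UNIV (\<lambda>i. real ` {..r i})"
    by (auto simp: PiE_UNIV_domain intro!: image_eqI[where x="vec_nth _"])
  ultimately show "finite ?S" using finite_subset by blast
qed

text \<open>A counterexample \<open>z\<close> nearest to \<open>y\<close> could be moved closer to \<open>y\<close> by one exchange.\<close>

lemma polymatroid_local_min:
  assumes y: "y \<in> B" and closed: "\<And>i j. \<lbrakk>i \<in> D; y - axis i 1 + axis j 1 \<in> B\<rbrakk> \<Longrightarrow> j \<in> D"
    and z: "z \<in> B"
  shows "indicator_vec D \<bullet> y \<le> indicator_vec D \<bullet> z"
proof (rule ccontr)
  assume not_min: "\<not> ?thesis"
  define dst where "dst x = (\<Sum>k\<in>UNIV. \<bar>x $ k - y $ k\<bar>)" for x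
  let ?Z = "{x\<in>B. indicator_vec D \<bullet> x < indicator_vec D \<bullet> y}"
  have "finite ?Z" "?Z \<noteq> {}" using finite_polymatroid z not_min by auto
  then obtain z where z: "z \<in> B" "indicator_vec D \<bullet> z < indicator_vec D \<bullet> y"
    and min: "\<And>x. x \<in> ?Z \<Longrightarrow> dst z \<le> dst x"
    using arg_min_if_finite(1)[of ?Z dst] arg_min_least[of ?Z _ dst] by blast
  have "\<exists>i\<in>D. z $ i < y $ i"
    using z(2) unfolding inner_indicator_vec by (meson not_le sum_mono)
  then obtain i where i: "i \<in> D" "z $ i < y $ i" by blast
  \<comment> \<open>Closedness puts \<open>j\<close> into \<open>D\<close>, so the return exchange
    at \<open>z\<close>, which removes \<open>axis j 1\<close> and adds some
    \<open>axis k 1\<close>, cannot raise the sum over \<open>D\<close>.\<close>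
  then obtain j where j: "y $ j < z $ j" "y - axis i 1 + axis j 1 \<in> B"
    using polymatroid_exchange y z by blast
  then have "j \<in> D" using closed i by blast
  obtain k where k: "z $ k < y $ k" "z - axis j 1 + axis k 1 \<in> B"
    using polymatroid_exchange y z j by blast
  let ?x = "z - axis j 1 + axis k 1"
  have "indicator_vec D \<bullet> ?x \<le> indicator_vec D \<bullet> z"
    using \<open>j \<in> D\<close> by (simp add: inner_add_right inner_diff_right inner_indicator_vec_axis)
  then have "dst z \<le> dst ?x" using min k z by simp
  have nat: "z $ l \<in> \<nat>" "y $ l \<in> \<nat>" for l using polymatroid_nth y z by blast+
  \<comment> \<open>Integrality turns a strict inequality into a gap of at least 1, so the exchange
    does not overshoot \<open>y\<close> at \<open>j\<close> or \<open>k\<close>.\<close>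
  have step: "x + 1 \<le> x'" if "x < x'" "x \<in> \<nat>" "x' \<in> \<nat>" for x x' :: real
    using that by (auto elim!: Nats_cases)
  have jk: "j \<noteq> k" using j k by auto
  have "dst ?x < dst z"
    unfolding dst_def
  proof (rule sum_strict_mono_ex1)
    show "\<forall>l\<in>UNIV. \<bar>?x $ l - y $ l\<bar> \<le> \<bar>z $ l - y $ l\<bar>"
    proof
      fix l
      show "\<bar>?x $ l - y $ l\<bar> \<le> \<bar>z $ l - y $ l\<bar>"
        using step[OF j(1)] step[OF k(1)] nat jk by (auto simp: axis_def)
    qed
    show "\<exists>l\<in>UNIV. \<bar>?x $ l - y $ l\<bar> < \<bar>z $ l - y $ l\<bar>"
      using step[OF j(1)] nat jk by (intro bexI[of _ j]) (auto simp: axis_def)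
  qed auto
  then show False using \<open>dst z \<le> dst ?x\<close> by simp
qed

text \<open>Exchange from \<open>y - axis j 1 + axis k 1\<close> towards
  \<open>y - axis i 1 + axis j 1\<close> at \<open>i\<close>: for distinct indices, \<open>j\<close>
  is the only coordinate in which the former is smaller, so the exchange must add
  \<open>axis j 1\<close>.\<close>

lemma polymatroid_exchange_trans:
  assumes y: "y \<in> B" and ij: "y - axis i 1 + axis j 1 \<in> B" and jk: "y - axis j 1 + axis k 1 \<in> B"
  shows "y - axis i 1 + axis k 1 \<in> B"
proof (cases "i = j \<or> j = k \<or> i = k")
  case True
  then show ?thesis using assms by auto
next
  case False
  let ?u = "y - axis i 1 + axis j 1" and ?v = "y - axis j 1 + axis k 1"
  have "?v $ i > ?u $ i" using False by (simp add: axis_def)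
  then obtain l where l: "?v $ l < ?u $ l" "?v - axis i 1 + axis l 1 \<in> B"
    using polymatroid_exchange[OF jk ij] by blast
  have "l = j" using l(1) False by (auto simp: axis_def split: if_splits)
  then show ?thesis using l(2) by (simp add: algebra_simps)
qed

lemma polymatroid_hole_free:
  assumes u: "u \<in> convex hull B" "\<And>i. u $ i \<in> \<nat>"
  shows "u \<in> B"
proof -
  define dst where "dst x = (\<Sum>k\<in>UNIV. \<bar>x $ k - u $ k\<bar>)" for x
  have "B \<noteq> {}" using B by (simp add: discrete_polymatroid_def)
  then obtain y where y: "y \<in> B" and min: "\<And>x. x \<in> B \<Longrightarrow> dst y \<le> dst x"
    using arg_min_if_finite(1)[OF finite_polymatroid, of dst] arg_min_least[OF finite_polymatroid, of _ dst]
    by blast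
  have tot: "(\<Sum>k\<in>UNIV. u $ k) = real d"
  proof -
    have "B \<subseteq> {x. indicator_vec UNIV \<bullet> x = real d}"
      using polymatroid_nth(4) by (auto simp: inner_indicator_vec)
    then have "convex hull B \<subseteq> {x. indicator_vec UNIV \<bullet> x = real d}"
      by (intro hull_minimal convex_hyperplane)
    then show ?thesis using u(1) by (auto simp: inner_indicator_vec)
  qed
  have step: "x + 1 \<le> x'" if "x < x'" "x \<in> \<nat>" "x' \<in> \<nat>" for x x' :: real
    using that by (auto elim!: Nats_cases)
  have nat: "y $ l \<in> \<nat>" "u $ l \<in> \<nat>" for l using polymatroid_nth y u by blast+
  define D where "D = {k. \<exists>i. y $ i > u $ i \<and> (k = i \<or> y - axis i 1 + axis k 1 \<in> B)}"
  \<comment> \<open>An exchange from a coordinate where \<open>y\<close> is too large to one where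
    it is too small would bring \<open>y\<close> nearer to \<open>u\<close>.\<close>
  have D_ge: "y $ k \<ge> u $ k" if "k \<in> D" for k
  proof (rule ccontr)
    assume k: "\<not> y $ k \<ge> u $ k"
    with that obtain i where i: "y $ i > u $ i" "y - axis i 1 + axis k 1 \<in> B"
      by (auto simp: D_def)
    let ?x = "y - axis i 1 + axis k 1"
    have ik: "i \<noteq> k" using i k by auto
    have k': "y $ k < u $ k" using k by simp
    have "dst ?x < dst y"
      unfolding dst_def
    proof (rule sum_strict_mono_ex1)
      show "\<forall>l\<in>UNIV. \<bar>?x $ l - u $ l\<bar> \<le> \<bar>y $ l - u $ l\<bar>"
      proof
        fix l
        show "\<bar>?x $ l - u $ l\<bar> \<le> \<bar>y $ l - u $ l\<bar>"
          using step[OF i(1)] step[OF k'] nat ik by (auto simp: axis_def)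
      qed
      show "\<exists>l\<in>UNIV. \<bar>?x $ l - u $ l\<bar> < \<bar>y $ l - u $ l\<bar>"
        using step[OF i(1)] nat ik by (intro bexI[of _ i]) (auto simp: axis_def)
    qed auto
    then show False using min[OF i(2)] by simp
  qed
  \<comment> \<open>Transitivity makes \<open>D\<close> closed under exchanges at \<open>y\<close>.
    The resulting minimality over \<open>B\<close> passes to the hull, hence to
    \<open>u\<close>.\<close>
  have "indicator_vec D \<bullet> y \<le> indicator_vec D \<bullet> z" if "z \<in> B" for z
  proof (rule polymatroid_local_min[OF y _ that])
    fix i j assume "i \<in> D" "y - axis i 1 + axis j 1 \<in> B"
    then show "j \<in> D" unfolding D_def using polymatroid_exchange_trans[OF y] by blast
  qed
  then have "B \<subseteq> {x. indicator_vec D \<bullet> x \<ge> indicator_vec D \<bullet> y}" by blast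
  then have "convex hull B \<subseteq> {x. indicator_vec D \<bullet> x \<ge> indicator_vec D \<bullet> y}"
    by (intro hull_minimal convex_halfspace_ge)
  then have "(\<Sum>k\<in>D. y $ k) \<le> (\<Sum>k\<in>D. u $ k)" using u by (auto simp: inner_indicator_vec)
  \<comment> \<open>Every coordinate with an excess of \<open>y\<close> lies in \<open>D\<close>; by
    \<open>D_ge\<close> nothing in \<open>D\<close> could compensate for it.\<close>
  have le: "y $ k \<le> u $ k" for k
  proof (rule ccontr)
    assume "\<not> y $ k \<le> u $ k"
    then have "k \<in> D" "u $ k < y $ k" by (auto simp: D_def not_le)
    then have "(\<Sum>k\<in>D. u $ k) < (\<Sum>k\<in>D. y $ k)" using D_ge by (intro sum_strict_mono_ex1) auto
    then show False using \<open>(\<Sum>k\<in>D. y $ k) \<le> (\<Sum>k\<in>D. u $ k)\<close> by simp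
  qed
  have "y $ k = u $ k" for k
  proof (rule ccontr)
    assume "y $ k \<noteq> u $ k"
    then have "(\<Sum>k\<in>UNIV. y $ k) < (\<Sum>k\<in>UNIV. u $ k)"
      using le by (intro sum_strict_mono_ex1) (auto simp: less_le)
    then show False using tot polymatroid_nth(4)[OF y] by simp
  qed
  then have "y = u" by (simp add: Finite_Cartesian_Product.vec_eq_iff)
  then show ?thesis using y by simp
qed

text \<open>If the edge maximises \<open>p\<close> and \<open>i\<close> has minimal \<open>p $ i\<close> among the coordinates with \<open>a $ i > b $ i\<close>,
  then an exchange from \<open>a\<close> at \<open>i\<close>, followed by one from \<open>b\<close>, cannot change the value of \<open>p\<close>.\<close>

lemma polymatroid_edge_root:
  assumes E: "E edge_of convex hull B"
  obtains a i j where "i \<noteq> j" "a \<in> B" "a - axis i 1 + axis j 1 \<in> B"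
    "a \<in> E" "a - axis i 1 + axis j 1 \<in> E"
proof -
  let ?P = "convex hull B"
  have P: "polytope ?P" using finite_polymatroid polytope_def by blast
  obtain a b where ab: "E = closed_segment a b" "a \<noteq> b" "a extreme_point_of ?P" "b extreme_point_of ?P"
    using edge_of_polytope_segment[OF P E] by blast
  have aB: "a \<in> B" and bB: "b \<in> B" using ab extreme_point_of_convex_hull by blast+
  have "E exposed_face_of ?P"
    using E exposed_face_of_polyhedron P polytope_imp_polyhedron by (auto simp: edge_of_def)
  then obtain p \<beta> where p: "?P \<subseteq> {x. p \<bullet> x \<le> \<beta>}" "E = ?P \<inter> {x. p \<bullet> x = \<beta>}"
    unfolding exposed_face_of_def by blast
  have le: "p \<bullet> x \<le> \<beta>" if "x \<in> B" for x using p(1) that hull_inc by fastforce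
  have pa: "p \<bullet> a = \<beta>" and pb: "p \<bullet> b = \<beta>" using p(2) ab(1) by auto
  let ?I = "{i. a $ i > b $ i}"
  have "?I \<noteq> {}"
  proof
    assume "?I = {}"
    then have le: "a $ k \<le> b $ k" for k by (metis (mono_tags, lifting) empty_iff mem_Collect_eq not_le)
    obtain k where "a $ k \<noteq> b $ k" using ab(2) by (auto simp: Finite_Cartesian_Product.vec_eq_iff)
    then have "(\<Sum>k\<in>UNIV. a $ k) < (\<Sum>k\<in>UNIV. b $ k)"
      using le by (intro sum_strict_mono_ex1) (auto simp: less_le)
    then show False using polymatroid_nth(4) aB bB by simp
  qed
  note ne = this
  define i where "i = arg_min_on (vec_nth p) ?I"
  have i: "i \<in> ?I" unfolding i_def by (rule arg_min_if_finite(1)[OF finite ne])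
  have min: "p $ i \<le> p $ k" if "k \<in> ?I" for k
    unfolding i_def by (rule arg_min_least[OF finite ne that])
  obtain j where j: "a $ j < b $ j" "a - axis i 1 + axis j 1 \<in> B"
    using polymatroid_exchange[OF aB bB, of i] i by blast
  obtain k where k: "b $ k < a $ k" "b - axis j 1 + axis k 1 \<in> B"
    using polymatroid_exchange[OF bB aB j(1)] by blast
  \<comment> \<open>Both exchanged points lie in \<open>B\<close>, where \<open>p\<close> is at most
    \<open>\<beta>\<close>, and \<open>a\<close> and \<open>b\<close> attain \<open>\<beta>\<close>.
    The inequalities close up to a cycle through \<open>i\<close>, \<open>j\<close>,
    \<open>k\<close>, so all are equalities.\<close>
  have "p $ j \<le> p $ i" using le[OF j(2)] pa by (simp add: inner_add_right inner_diff_right inner_axis)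
  moreover have "p $ k \<le> p $ j" using le[OF k(2)] pb by (simp add: inner_add_right inner_diff_right inner_axis)
  moreover have "p $ i \<le> p $ k" using min k(1) by simp
  ultimately have "p \<bullet> (a - axis i 1 + axis j 1) = \<beta>"
    using pa by (simp add: inner_add_right inner_diff_right inner_axis)
  then have "a - axis i 1 + axis j 1 \<in> E" using p(2) j(2) by (simp add: hull_inc)
  moreover have "i \<noteq> j" using i j by auto
  ultimately show thesis using that aB j ab(1) by simp
qed

end

section \<open>Polytopes whose edges are parallel to roots\<close>


text \<open>The continuous counterpart of an exchange at \<open>w\<close>: any positive step length
  is allowed, so only the directions \<open>axis j 1 - axis i 1\<close> in the cone of feasible
  directions matter. On a convex set this is a preorder on the coordinates.\<close>

definition feasible_root :: "(real ^ 'm::finite) set \<Rightarrow> real ^ 'm \<Rightarrow> 'm \<Rightarrow> 'm \<Rightarrow> bool" where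
  "feasible_root P w i j \<longleftrightarrow> (\<exists>\<epsilon>>0. w + \<epsilon> *\<^sub>R (axis j 1 - axis i 1) \<in> P)"

lemma convex_shorter_step:
  assumes "convex P" "w \<in> P" "w + \<epsilon> *\<^sub>R x \<in> P" "0 \<le> \<delta>" "\<delta> \<le> \<epsilon>"
  shows "w + \<delta> *\<^sub>R x \<in> P"
proof (cases "\<epsilon> = 0")
  case False
  have "w + \<delta> *\<^sub>R x = (1 - \<delta> / \<epsilon>) *\<^sub>R w + (\<delta> / \<epsilon>) *\<^sub>R (w + \<epsilon> *\<^sub>R x)"
    using False by (simp add: algebra_simps)
  also have "\<dots> \<in> P" using assms False by (intro convexD_alt) auto
  finally show ?thesis .
qed (use assms in auto)

lemma feasible_root_refl: "w \<in> P \<Longrightarrow> feasible_root P w i i"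
  unfolding feasible_root_def by (intro exI[of _ 1]) auto

text \<open>Shorten both steps to a common length; in the midpoint of the two end points the
  contributions at \<open>j\<close> cancel.\<close>

lemma feasible_root_trans:
  assumes "convex P" "w \<in> P" "feasible_root P w i j" "feasible_root P w j k"
  shows "feasible_root P w i k"
proof -
  obtain \<epsilon> \<delta> where e: "\<epsilon> > 0" "w + \<epsilon> *\<^sub>R (axis j 1 - axis i 1) \<in> P"
    "\<delta> > 0" "w + \<delta> *\<^sub>R (axis k 1 - axis j 1) \<in> P"
    using assms(3,4) unfolding feasible_root_def by blast
  define \<gamma> where "\<gamma> = min \<epsilon> \<delta>"
  have \<gamma>: "0 < \<gamma>" "\<gamma> \<le> \<epsilon>" "\<gamma> \<le> \<delta>" using e by (auto simp: \<gamma>_def)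
  have "w + \<gamma> *\<^sub>R (axis j 1 - axis i 1) \<in> P"
    by (rule convex_shorter_step[OF assms(1,2) e(2)]) (use \<gamma> in auto)
  moreover have "w + \<gamma> *\<^sub>R (axis k 1 - axis j 1) \<in> P"
    by (rule convex_shorter_step[OF assms(1,2) e(4)]) (use \<gamma> in auto)
  ultimately have "midpoint (w + \<gamma> *\<^sub>R (axis j 1 - axis i 1)) (w + \<gamma> *\<^sub>R (axis k 1 - axis j 1)) \<in> P"
    using assms(1) by (meson convex_contains_segment midpoint_in_closed_segment subsetD)
  also have "midpoint (w + \<gamma> *\<^sub>R (axis j 1 - axis i 1)) (w + \<gamma> *\<^sub>R (axis k 1 - axis j 1))
      = w + (\<gamma> / 2) *\<^sub>R (axis k 1 - axis i 1)"
    by (simp add: midpoint_def Finite_Cartesian_Product.vec_eq_iff algebra_simps)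
  finally show ?thesis
    unfolding feasible_root_def using \<gamma>(1) by (intro exI[of _ "\<gamma> / 2"]) auto
qed

lemma inner_indicator_vec_root:
  "indicator_vec D \<bullet> (axis j 1 - axis i 1) = (if j \<in> D then 1 else 0) - (if i \<in> D then 1 else 0)"
  by (simp add: inner_diff_right inner_indicator_vec_axis)

text \<open>Two points differing by a root fix the direction of the segment up to sign;
  \<open>k\<close> and \<open>l\<close> are \<open>i\<close> and \<open>j\<close> in the order that
  points from \<open>w\<close> to \<open>b\<close>.\<close>

lemma segment_root_direction:
  fixes w :: "real ^ 'm::finite"
  assumes a: "i \<noteq> j" "a \<in> closed_segment w b" "a - axis i 1 + axis j 1 \<in> closed_segment w b"
  obtains k l t where "{k, l} = {i, j}" "t > 0" "b = w + t *\<^sub>R (axis l 1 - axis k 1)"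
proof -
  obtain s where s: "a = w + s *\<^sub>R (b - w)"
    using a(2) by (auto simp: closed_segment_def algebra_simps)
  obtain s' where s': "a - axis i 1 + axis j 1 = w + s' *\<^sub>R (b - w)"
    using a(3) by (auto simp: closed_segment_def algebra_simps)
  have "axis j 1 - axis i 1 = (w + s' *\<^sub>R (b - w)) - (w + s *\<^sub>R (b - w))"
    unfolding s'[symmetric] s[symmetric] by simp
  then have root: "axis j 1 - axis i 1 = (s' - s) *\<^sub>R (b - w)"
    by (simp add: scaleR_left_diff_distrib)
  moreover have "axis j 1 - axis i (1::real) \<noteq> 0" using a(1) by (auto simp: axis_eq_axis)
  ultimately have "s' \<noteq> s" by auto
  show thesis
  proof (cases "s' > s")
    case True
    then show thesis using that[of i j "1 / (s' - s)"] root by simp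
  next
    case False
    have "axis i 1 - axis j 1 = - (axis j (1::real) - axis i 1)" by simp
    also have "\<dots> = (s - s') *\<^sub>R (b - w)" unfolding root by (simp add: algebra_simps)
    finally show thesis using that[of j i "1 / (s - s')"] False \<open>s' \<noteq> s\<close>
      by (simp add: insert_commute)
  qed
qed

context
  fixes P :: "(real ^ 'm::finite) set"
  assumes P: "polytope P"
    and edge_root: "\<And>E. E edge_of P \<Longrightarrow> \<exists>a i j. i \<noteq> j \<and> a \<in> E \<and> a - axis i 1 + axis j 1 \<in> E"
    and vertex_Nats: "\<And>v i. v extreme_point_of P \<Longrightarrow> v $ i \<in> \<nat>"
begin

text \<open>Otherwise some edge at \<open>w\<close> decreases the sum over \<open>R\<close>. Its
  direction is a feasible root, and a root decreases this sum only by leaving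
  \<open>R\<close>.\<close>

lemma root_polytope_vertex_local_min:
  assumes w: "w extreme_point_of P"
    and closed: "\<And>i j. \<lbrakk>i \<in> R; feasible_root P w i j\<rbrakk> \<Longrightarrow> j \<in> R"
    and z: "z \<in> P"
  shows "indicator_vec R \<bullet> w \<le> indicator_vec R \<bullet> z"
proof (rule ccontr)
  assume "\<not> ?thesis"
  then obtain b where b: "closed_segment w b edge_of P" "indicator_vec R \<bullet> b < indicator_vec R \<bullet> w"
    using improving_edge[OF P w z, of "indicator_vec R"] by (metis not_le)
  have bP: "b \<in> P" using b(1) edge_of_imp_subset by blast
  obtain a i j where a: "i \<noteq> j" "a \<in> closed_segment w b" "a - axis i 1 + axis j 1 \<in> closed_segment w b"
    using edge_root[OF b(1)] by blast
  obtain i j t where ij: "t > 0" "b = w + t *\<^sub>R (axis j 1 - axis i 1)"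
    using segment_root_direction[OF a] by metis
  then have "feasible_root P w i j" unfolding feasible_root_def using bP ij(1) by auto
  moreover have "t * (indicator_vec R \<bullet> (axis j 1 - axis i 1)) < 0"
    using b(2) unfolding ij(2) by (simp add: inner_add_right)
  then have "i \<in> R" "j \<notin> R"
    using ij(1) by (auto simp: inner_indicator_vec_root mult_less_0_iff split: if_splits)
  ultimately show False using closed by blast
qed

text \<open>Write \<open>w\<close> as a convex combination of vertices. Moving one vertex of
  positive weight along a root moves \<open>w\<close> along the same root, so \<open>R\<close> is
  closed at each such vertex too. All of them are therefore minimisers, and so is
  \<open>w\<close>.\<close>

lemma root_polytope_local_min:
  assumes w: "w \<in> P"
    and closed: "\<And>i j. \<lbrakk>i \<in> R; feasible_root P w i j\<rbrakk> \<Longrightarrow> j \<in> R"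
  shows "\<And>z. z \<in> P \<Longrightarrow> indicator_vec R \<bullet> w \<le> indicator_vec R \<bullet> z"
    and "\<exists>v. v extreme_point_of P \<and> indicator_vec R \<bullet> v = indicator_vec R \<bullet> w"
proof -
  define V where "V = {v. v extreme_point_of P}"
  have V: "finite V"
    unfolding V_def by (rule finite_polyhedron_extreme_points[OF polytope_imp_polyhedron[OF P]])
  have P_hull: "P = convex hull V"
    unfolding V_def by (rule Krein_Milman_Minkowski[OF polytope_imp_compact[OF P] polytope_imp_convex[OF P]])
  obtain u where u: "\<And>x. x \<in> V \<Longrightarrow> 0 \<le> u x" "sum u V = 1" "(\<Sum>x\<in>V. u x *\<^sub>R x) = w"
    using w V unfolding P_hull by (auto simp: convex_hull_finite)
  have vmin: "indicator_vec R \<bullet> v \<le> indicator_vec R \<bullet> z" if v: "v \<in> V" "u v > 0" and z: "z \<in> P" for v z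
  proof (rule root_polytope_vertex_local_min[OF _ _ z])
    fix i j assume "i \<in> R" "feasible_root P v i j"
    then obtain \<epsilon> where e: "\<epsilon> > 0" "v + \<epsilon> *\<^sub>R (axis j 1 - axis i 1) \<in> P" (is "v + _ *\<^sub>R ?x \<in> P")
      unfolding feasible_root_def by blast
    have "(\<Sum>x\<in>V. u x *\<^sub>R (if x = v then v + \<epsilon> *\<^sub>R ?x else x)) \<in> P"
      using e by (intro convex_sum[OF V polytope_imp_convex[OF P] u(2) u(1)]) (auto simp: V_def extreme_point_of_def)
    also have "(\<Sum>x\<in>V. u x *\<^sub>R (if x = v then v + \<epsilon> *\<^sub>R ?x else x))
        = (\<Sum>x\<in>V. u x *\<^sub>R x + (if x = v then (u v * \<epsilon>) *\<^sub>R ?x else 0))"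
      by (intro sum.cong) (auto simp: scaleR_add_right)
    also have "\<dots> = w + (u v * \<epsilon>) *\<^sub>R ?x"
      using V v(1) u(3) by (simp add: sum.distrib)
    finally have "feasible_root P w i j"
      unfolding feasible_root_def using v e by (intro exI[of _ "u v * \<epsilon>"]) auto
    then show "j \<in> R" using closed \<open>i \<in> R\<close> by blast
  qed (use v in \<open>auto simp: V_def\<close>)
  show min: "indicator_vec R \<bullet> w \<le> indicator_vec R \<bullet> z" if z: "z \<in> P" for z
  proof -
    have "indicator_vec R \<bullet> w = (\<Sum>x\<in>V. u x * (indicator_vec R \<bullet> x))"
      unfolding u(3)[symmetric] inner_sum_right by simp
    also have "\<dots> \<le> (\<Sum>x\<in>V. u x * (indicator_vec R \<bullet> z))"
    proof (rule sum_mono)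
      fix x assume "x \<in> V"
      then show "u x * (indicator_vec R \<bullet> x) \<le> u x * (indicator_vec R \<bullet> z)"
        using vmin[of x z] z u(1)[of x] by (cases "u x = 0") (auto intro: mult_left_mono)
    qed
    also have "\<dots> = indicator_vec R \<bullet> z" using u(2) by (simp add: sum_distrib_right[symmetric])
    finally show ?thesis .
  qed
  have "\<exists>v\<in>V. u v > 0"
    using u(1,2) by (metis less_eq_real_def sum.neutral zero_neq_one)
  then obtain v where v: "v \<in> V" "u v > 0" by blast
  then have "v extreme_point_of P" "v \<in> P" by (auto simp: V_def extreme_point_of_def)
  then show "\<exists>v. v extreme_point_of P \<and> indicator_vec R \<bullet> v = indicator_vec R \<bullet> w"
    using order_antisym[OF vmin[OF v w] min] by blast
qed

lemma root_polytope_exchange: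
  assumes u: "u \<in> P" "\<And>k. u $ k \<in> \<nat>" and v: "v \<in> P" and i: "u $ i > v $ i"
  obtains j where "u $ j < v $ j" "u - axis i 1 + axis j 1 \<in> P"
proof -
  define R where "R w = {k. feasible_root P w i k}" for w
  have R_closed: "\<And>k k'. \<lbrakk>k \<in> R w; feasible_root P w k k'\<rbrakk> \<Longrightarrow> k' \<in> R w" if "w \<in> P" for w
    using feasible_root_trans[OF polytope_imp_convex[OF P] that] by (auto simp: R_def)
  have iR: "i \<in> R w" if "w \<in> P" for w using feasible_root_refl that by (simp add: R_def)
  have "(\<Sum>k\<in>R u. u $ k) \<le> (\<Sum>k\<in>R u. v $ k)"
    using root_polytope_local_min(1)[OF u(1) R_closed[OF u(1)] v] by (simp add: inner_indicator_vec)
  \<comment> \<open>The sum over \<open>R u\<close> is no larger at \<open>u\<close> than at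
    \<open>v\<close>, so the excess of \<open>u\<close> at \<open>i\<close> has to be made up
    elsewhere in \<open>R u\<close>.\<close>
  have "\<exists>j\<in>R u. u $ j < v $ j"
  proof (rule ccontr)
    assume "\<not> ?thesis"
    then have "(\<Sum>k\<in>R u. v $ k) < (\<Sum>k\<in>R u. u $ k)"
      using i iR[OF u(1)] by (intro sum_strict_mono_ex1) (auto simp: not_less)
    then show False using \<open>(\<Sum>k\<in>R u. u $ k) \<le> (\<Sum>k\<in>R u. v $ k)\<close> by simp
  qed
  then obtain j where j: "u $ j < v $ j" "feasible_root P u i j" by (auto simp: R_def)
  let ?x = "axis j 1 - axis i 1 :: real ^ 'm"
  obtain \<epsilon> where e: "\<epsilon> > 0" "u + \<epsilon> *\<^sub>R ?x \<in> P" using j(2) unfolding feasible_root_def by blast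
  \<comment> \<open>The feasible step lengths, capped at 1; the aim is that the largest one,
    \<open>t\<close>, equals 1.\<close>
  define T where "T = {0..1} \<inter> (\<lambda>t. u + t *\<^sub>R ?x) -` P"
  have "closed ((\<lambda>t. u + t *\<^sub>R ?x) -` P)"
    using P polytope_imp_closed by (intro closed_vimage continuous_intros) auto
  then have "compact T" unfolding T_def by (intro compact_Int_closed) auto
  moreover have "min \<epsilon> 1 \<in> T"
    unfolding T_def using e convex_shorter_step[OF polytope_imp_convex[OF P] u(1) e(2), of "min \<epsilon> 1"] by auto
  ultimately obtain t where t: "t \<in> T" and tmax: "\<And>s. s \<in> T \<Longrightarrow> s \<le> t"
    using compact_attains_sup[of T] by blast
  have t01: "0 < t" "t \<le> 1" using tmax[OF \<open>min \<epsilon> 1 \<in> T\<close>] e(1) t by (auto simp: T_def)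
  define w where "w = u + t *\<^sub>R ?x"
  have wP: "w \<in> P" using t by (auto simp: T_def w_def)
  have "t = 1"
  proof (rule ccontr)
    assume "t \<noteq> 1"
    then have "t < 1" using t01 by simp
    \<comment> \<open>Otherwise the step could be prolonged beyond \<open>t\<close>.\<close>
    have "j \<notin> R w"
    proof
      assume "j \<in> R w"
      then obtain \<delta> where \<delta>: "\<delta> > 0" "w + \<delta> *\<^sub>R ?x \<in> P" by (auto simp: R_def feasible_root_def)
      define s where "s = min \<delta> (1 - t)"
      have s: "0 < s" "s \<le> 1 - t" "s \<le> \<delta>" using \<delta> \<open>t < 1\<close> by (auto simp: s_def)
      then have "w + s *\<^sub>R ?x \<in> P" using convex_shorter_step[OF polytope_imp_convex[OF P] wP \<delta>(2)] by simp
      moreover have "w + s *\<^sub>R ?x = u + (t + s) *\<^sub>R ?x" by (simp add: w_def algebra_simps)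
      ultimately have "t + s \<in> T" using t01 s by (simp add: T_def)
      then show False using tmax s(1) by fastforce
    qed
    \<comment> \<open>The sum over \<open>R w\<close> at \<open>w\<close> is that at
      \<open>u\<close> minus \<open>t\<close>, because \<open>i\<close> is in \<open>R w\<close> and
      \<open>j\<close> is not. It is also the sum at a vertex, so \<open>t\<close> would be an
      integer strictly between 0 and 1.\<close>
    obtain v0 where v0: "v0 extreme_point_of P" "indicator_vec (R w) \<bullet> v0 = indicator_vec (R w) \<bullet> w"
      using root_polytope_local_min(2)[OF wP, of "R w"] R_closed[OF wP] by blast
    have "indicator_vec (R w) \<bullet> w = indicator_vec (R w) \<bullet> u - t"
      using iR[OF wP] \<open>j \<notin> R w\<close> unfolding w_def inner_add_right inner_scaleR_right inner_indicator_vec_root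
      by simp
    then have "t = (\<Sum>k\<in>R w. u $ k) - (\<Sum>k\<in>R w. v0 $ k)"
      using v0(2) by (simp add: inner_indicator_vec)
    also have "\<dots> \<in> \<int>"
      using u(2) vertex_Nats[OF v0(1)] Nats_subset_Ints by (intro Ints_diff Ints_sum) auto
    finally show False using t01 \<open>t < 1\<close> by (auto elim!: Ints_cases)
  qed
  then have "u - axis i 1 + axis j 1 \<in> P" using wP by (simp add: w_def algebra_simps)
  then show thesis using that j(1) by blast
qed

end

section \<open>The hypersimplex\<close>


text \<open>0 and 1 are extreme points of the interval, so a proper convex combination attains them
  only if both ends do.\<close>

lemma open_segment_nth_extremal:
  fixes a b :: "real ^ 'n::finite"
  assumes x: "x \<in> open_segment a b" and ab: "a $ j \<in> {0..1}" "b $ j \<in> {0..1}"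
    and "x $ j = 0 \<or> x $ j = 1"
  shows "a $ j = x $ j" "b $ j = x $ j"
proof -
  obtain u where u: "0 < u" "u < 1" "x = (1 - u) *\<^sub>R a + u *\<^sub>R b"
    using x by (auto simp: in_segment)
  have xj: "x $ j = (1 - u) * a $ j + u * b $ j" by (simp add: u(3))
  have "(1 - u) * a $ j \<ge> 0" "u * b $ j \<ge> 0" "(1 - u) * (1 - a $ j) \<ge> 0" "u * (1 - b $ j) \<ge> 0"
    using u(1,2) ab by auto
  moreover have "(1 - u) * (1 - a $ j) + u * (1 - b $ j) = 1 - x $ j"
    unfolding xj by (simp add: algebra_simps)
  ultimately have "(1 - u) * a $ j = 0 \<and> u * b $ j = 0 \<and> x $ j = 0
      \<or> (1 - u) * (1 - a $ j) = 0 \<and> u * (1 - b $ j) = 0 \<and> x $ j = 1"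
    using assms(4) xj by linarith
  then show "a $ j = x $ j" "b $ j = x $ j" using u(1,2) by auto
qed

lemma sum_indicator_vec: "(\<Sum>j\<in>UNIV. indicator_vec I $ j) = real (card I)"
proof -
  have "(\<Sum>j\<in>UNIV. indicator_vec I $ j) = (\<Sum>j\<in>UNIV. if j \<in> I then 1 else 0)"
    by (simp add: indicator_vec_nth)
  then show ?thesis by (simp add: sum.If_cases)
qed

lemma indicator_vec_exchange:
  assumes "i \<in> I" "l \<notin> I"
  shows "indicator_vec I - axis i 1 + axis l 1 = indicator_vec (insert l (I - {i}))"
  using assms by (auto simp: Finite_Cartesian_Product.vec_eq_iff indicator_vec_nth axis_def)

lemma indicator_vec_in_hypersimplex: "card I = d \<Longrightarrow> indicator_vec I \<in> hypersimplex d"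
  by (auto simp: hypersimplex_def indicator_vec_nth sum_indicator_vec[unfolded indicator_vec_nth])

lemma hypersimplex_eq_cbox_Int_hyperplane:
  "hypersimplex d = cbox 0 1 \<inter> {a :: real ^ 'n::finite. indicator_vec UNIV \<bullet> a = real d}"
  by (auto simp: hypersimplex_def mem_box_cart inner_indicator_vec)

lemma convex_hypersimplex: "convex (hypersimplex d :: (real ^ 'n::finite) set)"
  unfolding hypersimplex_eq_cbox_Int_hyperplane by (intro convex_Int convex_hyperplane) simp

lemma compact_hypersimplex: "compact (hypersimplex d :: (real ^ 'n::finite) set)"
  unfolding hypersimplex_eq_cbox_Int_hyperplane
  by (intro compact_Int_closed closed_hyperplane compact_cbox)

lemma extreme_point_of_hypersimplex_iff:
  fixes w :: "real ^ 'n::finite"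
  shows "w extreme_point_of hypersimplex d \<longleftrightarrow> (\<exists>I. card I = d \<and> w = indicator_vec I)"
proof
  assume "\<exists>I. card I = d \<and> w = indicator_vec I"
  then obtain I where I: "card I = d" "w = indicator_vec I" by blast
  have "w \<notin> open_segment a b" if "a \<in> hypersimplex d" "b \<in> hypersimplex d" for a b
  proof
    assume seg: "w \<in> open_segment a b"
    have "a $ j = b $ j" for j
      using open_segment_nth_extremal[OF seg, of j] that I(2)
      by (auto simp: hypersimplex_def indicator_vec_nth)
    then have "a = b" by (simp add: Finite_Cartesian_Product.vec_eq_iff)
    then show False using seg by simp
  qed
  then show "w extreme_point_of hypersimplex d"
    using I by (simp add: extreme_point_of_def indicator_vec_in_hypersimplex)
next
  assume w: "w extreme_point_of hypersimplex d"
  then have wH: "w \<in> hypersimplex d" by (simp add: extreme_point_of_def)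
  then have w01: "0 \<le> w $ j" "w $ j \<le> 1" for j
    by (auto simp: hypersimplex_def)
  have tot: "(\<Sum>j\<in>UNIV. w $ j) = real d" using wH by (auto simp: hypersimplex_def)
  have "w $ i = 0 \<or> w $ i = 1" for i
  proof (rule ccontr)
    assume i: "\<not> (w $ i = 0 \<or> w $ i = 1)"
    \<comment> \<open>The total is an integer, so a fractional coordinate cannot be the only
      one.\<close>
    have "\<exists>l. l \<noteq> i \<and> w $ l \<noteq> 0 \<and> w $ l \<noteq> 1"
    proof (rule ccontr)
      assume "\<not> ?thesis"
      then have "w $ l \<in> \<int>" if "l \<noteq> i" for l using that by (metis Ints_0 Ints_1)
      then have "(\<Sum>j\<in>UNIV - {i}. w $ j) \<in> \<int>" by (intro Ints_sum) auto
      moreover have "w $ i = real d - (\<Sum>j\<in>UNIV - {i}. w $ j)"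
        using tot sum.remove[of UNIV i "vec_nth w"] by simp
      ultimately have "w $ i \<in> \<int>" by simp
      then obtain z where "w $ i = of_int z" by (auto elim: Ints_cases)
      moreover have "0 < w $ i" "w $ i < 1" using i w01[of i] by auto
      ultimately show False by simp
    qed
    then obtain l where l: "l \<noteq> i" "w $ l \<noteq> 0" "w $ l \<noteq> 1" by blast
    \<comment> \<open>The largest amount that can be shifted between \<open>i\<close> and
      \<open>l\<close> in either direction within \<open>{0..1}\<close>; \<open>w\<close> is the
      midpoint of the two shifted points.\<close>
    define \<epsilon> where "\<epsilon> = min (min (w $ i) (1 - w $ i)) (min (w $ l) (1 - w $ l))"
    have e: "0 < \<epsilon>" "\<epsilon> \<le> w $ i" "\<epsilon> \<le> 1 - w $ i" "\<epsilon> \<le> w $ l" "\<epsilon> \<le> 1 - w $ l"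
      using w01[of i] w01[of l] i l by (auto simp: \<epsilon>_def less_le)
    let ?x = "axis i 1 - axis l 1 :: real ^ 'n"
    have in_H: "w + \<delta> *\<^sub>R ?x \<in> hypersimplex d" if "\<bar>\<delta>\<bar> = \<epsilon>" for \<delta>
    proof -
      have "indicator_vec UNIV \<bullet> (w + \<delta> *\<^sub>R ?x) = real d"
        by (simp add: inner_add_right inner_indicator_vec_root) (simp add: inner_indicator_vec tot)
      moreover have "(w + \<delta> *\<^sub>R ?x) $ j \<in> {0..1}" for j
        using e that w01[of j] l(1) by (auto simp: axis_def)
      ultimately show ?thesis by (auto simp: hypersimplex_def inner_indicator_vec)
    qed
    have "midpoint (w + \<epsilon> *\<^sub>R ?x) (w + (- \<epsilon>) *\<^sub>R ?x) = w" by (simp add: midpoint_def)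
    moreover have "(w + \<epsilon> *\<^sub>R ?x) $ i \<noteq> (w + (- \<epsilon>) *\<^sub>R ?x) $ i"
      using e(1) l(1) by (simp add: axis_def)
    then have "w + \<epsilon> *\<^sub>R ?x \<noteq> w + (- \<epsilon>) *\<^sub>R ?x" by metis
    ultimately have "w \<in> open_segment (w + \<epsilon> *\<^sub>R ?x) (w + (- \<epsilon>) *\<^sub>R ?x)"
      by (metis midpoint_in_open_segment)
    moreover have "w + \<epsilon> *\<^sub>R ?x \<in> hypersimplex d" "w + (- \<epsilon>) *\<^sub>R ?x \<in> hypersimplex d"
      using in_H[of \<epsilon>] in_H[of "- \<epsilon>"] e(1) by auto
    ultimately show False using w unfolding extreme_point_of_def by blast
  qed
  then have weq: "w = indicator_vec {j. w $ j = 1}"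
    by (auto simp: Finite_Cartesian_Product.vec_eq_iff indicator_vec_nth)
  have "real (card {j. w $ j = 1}) = real d"
    using arg_cong[OF weq, of "\<lambda>a. \<Sum>j\<in>UNIV. a $ j"] tot sum_indicator_vec[of "{j. w $ j = 1}"] by linarith
  then have "card {j. w $ j = 1} = d" by simp
  then show "\<exists>I. card I = d \<and> w = indicator_vec I" using weq by blast
qed

lemma hypersimplex_eq_hull:
  "hypersimplex d = convex hull {indicator_vec I :: real ^ 'n::finite |I. card I = d}"
proof -
  have "{w :: real ^ 'n. w extreme_point_of hypersimplex d} = {indicator_vec I |I. card I = d}"
    by (auto simp: extreme_point_of_hypersimplex_iff)
  then show ?thesis
    using Krein_Milman_Minkowski[OF compact_hypersimplex convex_hypersimplex] by metis
qed

lemma polytope_hypersimplex: "polytope (hypersimplex d :: (real ^ 'n::finite) set)"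
  unfolding polytope_def hypersimplex_eq_hull by (intro exI[of _ "{indicator_vec I |I. card I = d}"]) auto

text \<open>This makes \<open>polymatroid_edge_root\<close> available for the edges of the
  hypersimplex.\<close>

lemma discrete_polymatroid_uniform:
  assumes "d \<le> CARD('n::finite)"
  shows "discrete_polymatroid (\<lambda>_. 1) d {indicator_vec I :: real ^ 'n |I. card I = d}" (is "discrete_polymatroid _ _ ?B")
proof -
  have "?B \<noteq> {}" using obtain_subset_with_card_n[OF assms] by blast
  moreover have "\<exists>j. u $ j < v $ j \<and> u - axis i 1 + axis j 1 \<in> ?B"
    if u: "u \<in> ?B" and v: "v \<in> ?B" and i: "v $ i < u $ i" for u v :: "real ^ 'n" and i
  proof -
    obtain I J where IJ: "card I = d" "u = indicator_vec I" "card J = d" "v = indicator_vec J"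
      using u v by blast
    have iIJ: "i \<in> I" "i \<notin> J" using i IJ by (auto simp: indicator_vec_nth split: if_splits)
    have "\<not> J \<subseteq> I" using iIJ IJ by (metis card_subset_eq finite)
    then obtain l where l: "l \<in> J" "l \<notin> I" by blast
    have "u - axis i 1 + axis l 1 = indicator_vec (insert l (I - {i}))"
      using indicator_vec_exchange iIJ l IJ by blast
    moreover have "card (insert l (I - {i})) = d"
      using iIJ l IJ card_Suc_Diff1[of I i] by simp
    ultimately show ?thesis using l IJ by (intro exI[of _ l]) (auto simp: indicator_vec_nth)
  qed
  ultimately show ?thesis
    unfolding discrete_polymatroid_def by (auto simp: indicator_vec_nth sum_indicator_vec[unfolded indicator_vec_nth])
qed

lemma hypersimplex_edge_root:
  assumes "d \<le> CARD('n::finite)" and "F edge_of (hypersimplex d :: (real ^ 'n) set)"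
  shows "\<exists>a i j. i \<noteq> j \<and> a \<in> F \<and> a - axis i 1 + axis j 1 \<in> F"
proof -
  have "F edge_of convex hull {indicator_vec I :: real ^ 'n |I. card I = d}"
    using assms(2) by (simp only: hypersimplex_eq_hull)
  from polymatroid_edge_root[OF discrete_polymatroid_uniform[OF assms(1)] this]
  show ?thesis by metis
qed

text \<open>The segment consists of the points of the hypersimplex that agree with
  \<open>indicator_vec I\<close> outside \<open>i\<close> and \<open>l\<close>. The prescribed
  coordinates are 0 or 1, so this is a face by \<open>open_segment_nth_extremal\<close>.\<close>

lemma hypersimplex_edge:
  fixes I :: "'n::finite set"
  assumes I: "card I = d" and il: "i \<in> I" "l \<notin> I"
  shows "closed_segment (indicator_vec I) (indicator_vec I - axis i 1 + axis l 1) edge_of hypersimplex d"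
    (is "closed_segment ?a ?b edge_of _")
proof -
  have "i \<noteq> l" using il by auto
  have card: "card (insert l (I - {i})) = d" using il I card_Suc_Diff1[of I i] by simp
  have b: "?b = indicator_vec (insert l (I - {i}))" by (rule indicator_vec_exchange[OF il])
  have aH: "?a \<in> hypersimplex d" and bH: "?b \<in> hypersimplex d"
    using indicator_vec_in_hypersimplex I card b by metis+
  have in_seg: "x \<in> closed_segment ?a ?b"
    if x: "x \<in> hypersimplex d" and eq: "\<And>k. k \<noteq> i \<Longrightarrow> k \<noteq> l \<Longrightarrow> x $ k = ?a $ k" for x
  proof -
    have "x $ i + x $ l = 1"
    proof -
      have "(\<Sum>k\<in>UNIV. x $ k - ?a $ k) = 0"
        using x I by (simp add: sum_subtractf sum_indicator_vec hypersimplex_def)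
      also have "(\<Sum>k\<in>UNIV. x $ k - ?a $ k) = (\<Sum>k\<in>{i, l}. x $ k - ?a $ k)"
        using eq by (intro sum.mono_neutral_right) auto
      finally show ?thesis using il \<open>i \<noteq> l\<close> by (simp add: indicator_vec_nth)
    qed
    then have "x $ k = ((1 - x $ l) *\<^sub>R ?a + x $ l *\<^sub>R ?b) $ k" for k
      using il eq[of k] \<open>i \<noteq> l\<close>
      by (cases "k = i"; cases "k = l") (auto simp: indicator_vec_nth axis_def algebra_simps)
    then have "x = (1 - x $ l) *\<^sub>R ?a + x $ l *\<^sub>R ?b"
      unfolding Finite_Cartesian_Product.vec_eq_iff by blast
    moreover have "0 \<le> x $ l" "x $ l \<le> 1" using x by (auto simp: hypersimplex_def)
    ultimately show ?thesis unfolding closed_segment_def by blast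
  qed
  have seg_nth: "z $ k = ?a $ k" if z: "z \<in> closed_segment ?a ?b" and k: "k \<noteq> i" "k \<noteq> l" for z k
  proof -
    obtain u where "z = (1 - u) *\<^sub>R ?a + u *\<^sub>R ?b"
      using z unfolding closed_segment_def by blast
    then have "z $ k = ((1 - u) *\<^sub>R ?a + u *\<^sub>R ?b) $ k" by (rule arg_cong)
    then show ?thesis using k by (simp add: axis_def algebra_simps)
  qed
  have "closed_segment ?a ?b face_of hypersimplex d"
    unfolding face_of_def
  proof (intro conjI ballI impI)
    show "closed_segment ?a ?b \<subseteq> hypersimplex d"
      using aH bH convex_hypersimplex closed_segment_subset by blast
    fix x y z assume xy: "x \<in> hypersimplex d" "y \<in> hypersimplex d"
      and z: "z \<in> closed_segment ?a ?b" "z \<in> open_segment x y"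
    have "x $ k = ?a $ k \<and> y $ k = ?a $ k" if "k \<noteq> i" "k \<noteq> l" for k
      using open_segment_nth_extremal[OF z(2), of k] seg_nth[OF z(1) that] xy
      by (auto simp: hypersimplex_def indicator_vec_nth split: if_splits)
    then show "x \<in> closed_segment ?a ?b" "y \<in> closed_segment ?a ?b" using in_seg xy by blast+
  qed auto
  moreover have "?a \<noteq> ?b"
  proof
    assume "?a = ?b"
    then have "?a $ i = ?b $ i" by (rule arg_cong)
    then show False using \<open>i \<noteq> l\<close> by (simp add: axis_def)
  qed
  then have "aff_dim (closed_segment ?a ?b) = 1"
    by (simp add: segment_convex_hull aff_dim_convex_hull aff_dim_2)
  ultimately show ?thesis by (simp add: edge_of_def)
qed

section \<open>Sizes of the blocks\<close>

text \<open>Counting predecessors maps \<open>'n\<close> bijectively onto an initial segment of the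
  naturals, and block \<open>i\<close> onto the interval between two consecutive partial sums of
  \<open>r\<close>.\<close>

lemma card_block:
  fixes r :: "'m::{finite,linorder} \<Rightarrow> nat"
  assumes n: "CARD('n::{finite,linorder}) = (\<Sum>i\<in>UNIV. r i)"
  shows "card {j :: 'n. block r j = i} = r i"
proof -
  define p where "p j = card {..<j}" for j :: 'n
  have p_less: "p j < p j'" if "j < j'" for j j'
    unfolding p_def using that by (intro psubset_card_mono) auto
  have inj: "inj p" by (rule injI) (metis p_less less_irrefl neqE)
  have p_lt: "p j < CARD('n)" for j unfolding p_def by (intro psubset_card_mono) auto
  have range: "range p = {..<CARD('n)}"
    using p_lt inj by (intro card_subset_eq) (auto simp: card_image)
  have S_le: "(\<Sum>i'\<in>{..k}. r i') \<le> (\<Sum>i'\<in>{..<i}. r i')" if "k < i" for k i :: 'm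
    using that by (intro sum_mono2) auto
  have block_iff: "block r j = i \<longleftrightarrow> p j \<in> {(\<Sum>i'\<in>{..<i}. r i')..<(\<Sum>i'\<in>{..i}. r i')}" for j
  proof -
    let ?S = "{i. card {..<j} < (\<Sum>i'\<in>{..i}. r i')}"
    \<comment> \<open>\<open>Min ?S\<close> is only meaningful for nonempty \<open>?S\<close>; the
      last block always qualifies, as the partial sum up to it is \<open>CARD('n)\<close>.\<close>
    have "{..Max UNIV} = (UNIV :: 'm set)" by auto
    then have "Max UNIV \<in> ?S" using p_lt[of j] n by (simp add: p_def)
    then have ne: "?S \<noteq> {}" by blast
    show ?thesis
    proof
      assume i: "block r j = i"
      then have iS: "i \<in> ?S" using Min_in[OF finite ne] by (simp add: block_def)
      have "\<not> p j < (\<Sum>i'\<in>{..<i}. r i')"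
      proof
        assume lt: "p j < (\<Sum>i'\<in>{..<i}. r i')"
        then have ne': "{..<i} \<noteq> {}" by auto
        \<comment> \<open>The predecessor of \<open>i\<close>: the blocks before \<open>i\<close>
          are those up to \<open>?k\<close>, so \<open>?k\<close> would already qualify for the
          minimum.\<close>
        let ?k = "Max {..<i}"
        have k: "?k < i" using Max_in[OF finite ne'] by simp
        then have "{..<i} = {..?k}" by (auto intro: Max_ge)
        then have "?k \<in> ?S" using lt by (simp add: p_def)
        then have "i \<le> ?k" using i Min_le[OF finite, of ?k ?S] by (simp add: block_def)
        then show False using k by simp
      qed
      then show "p j \<in> {(\<Sum>i'\<in>{..<i}. r i')..<(\<Sum>i'\<in>{..i}. r i')}"
        using iS by (simp add: p_def)
    next
      assume p: "p j \<in> {(\<Sum>i'\<in>{..<i}. r i')..<(\<Sum>i'\<in>{..i}. r i')}"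
      have "Min ?S = i"
      proof (rule Min_eqI)
        fix k assume "k \<in> ?S"
        then show "i \<le> k" using S_le[of k i] p by (force simp: p_def not_le[symmetric])
      qed (use p in \<open>auto simp: p_def\<close>)
      then show "block r j = i" by (simp add: block_def)
    qed
  qed
  have "(\<Sum>i'\<in>{..i}. r i') \<le> CARD('n)" unfolding n by (intro sum_mono2) auto
  then have "{(\<Sum>i'\<in>{..<i}. r i')..<(\<Sum>i'\<in>{..i}. r i')} \<subseteq> range p" unfolding range by auto
  then have "card (p -` {(\<Sum>i'\<in>{..<i}. r i')..<(\<Sum>i'\<in>{..i}. r i')}) = (\<Sum>i'\<in>{..i}. r i') - (\<Sum>i'\<in>{..<i}. r i')"
    using card_vimage_inj[OF inj] by simp
  moreover have "{j. block r j = i} = p -` {(\<Sum>i'\<in>{..<i}. r i')..<(\<Sum>i'\<in>{..i}. r i')}"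
    unfolding block_iff vimage_def by (rule refl)
  moreover have "(\<Sum>i'\<in>{..i}. r i') = r i + (\<Sum>i'\<in>{..<i}. r i')"
  proof -
    have "{..i} = insert i {..<i}" by auto
    then show ?thesis by simp
  qed
  ultimately show ?thesis by simp
qed

section \<open>The matroid of a subspace\<close>


text \<open>The projection of \<open>L\<close> to the coordinates in \<open>I\<close> is injective;
  these are the spanning sets of the matroid of \<open>L\<close>.\<close>

definition vanishing_free :: "('k::field ^ 'n::finite) set \<Rightarrow> 'n set \<Rightarrow> bool" where
  "vanishing_free L I \<longleftrightarrow> (\<forall>x\<in>L. (\<forall>j\<in>I. x $ j = 0) \<longrightarrow> x = 0)"

text \<open>Minimality provides for each \<open>j\<close> in \<open>I\<close> a vector of
  \<open>L\<close> that restricts to the \<open>j\<close>-th unit vector on \<open>I\<close>. These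
  vectors form a basis: coefficients are read off on \<open>I\<close>, and a vector of
  \<open>L\<close> is determined by its restriction to \<open>I\<close>.\<close>

lemma card_minimal_vanishing_free:
  fixes L :: "('k::field ^ 'n::finite) set"
  assumes L: "vec.subspace L" and I: "vanishing_free L I"
    and min: "\<And>j. j \<in> I \<Longrightarrow> \<not> vanishing_free L (I - {j})"
  shows "card I = vec.dim L"
proof -
  have "\<exists>e. e \<in> L \<and> e $ j = 1 \<and> (\<forall>k\<in>I - {j}. e $ k = 0)" if "j \<in> I" for j
  proof -
    have "\<not> vanishing_free L (I - {j})" using min that by blast
    then obtain v where v: "v \<in> L" "\<forall>k\<in>I - {j}. v $ k = 0" "v \<noteq> 0"
      by (auto simp: vanishing_free_def)
    then have "v $ j \<noteq> 0" using I by (auto simp: vanishing_free_def)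
    then show ?thesis
      using v L by (intro exI[of _ "inverse (v $ j) *s v"]) (auto simp: vec.subspace_scale)
  qed
  then obtain e where e: "\<And>j. j \<in> I \<Longrightarrow> e j \<in> L" "\<And>j. j \<in> I \<Longrightarrow> e j $ j = 1"
    "\<And>j k. j \<in> I \<Longrightarrow> k \<in> I \<Longrightarrow> k \<noteq> j \<Longrightarrow> e j $ k = 0"
    by (metis DiffI singletonD)
  have comb: "(\<Sum>j\<in>I. c j *s e j) $ k = c k" if "k \<in> I" for c k
  proof -
    have "(\<Sum>j\<in>I. c j *s e j) $ k = (\<Sum>j\<in>I. if j = k then c k else 0)"
      unfolding sum_component by (rule sum.cong) (use e that in auto)
    then show ?thesis using that by simp
  qed
  have inj: "inj_on e I"
    using e by (intro inj_onI) (metis zero_neq_one)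
  have "vec.independent (e ` I)"
  proof
    assume "vec.dependent (e ` I)"
    then obtain u where u: "\<exists>v\<in>e ` I. u v \<noteq> 0" "(\<Sum>v\<in>e ` I. u v *s v) = 0"
      by (auto simp: vec.dependent_finite)
    then have "(\<Sum>j\<in>I. u (e j) *s e j) = 0" by (simp add: sum.reindex[OF inj])
    then have "u (e k) = 0" if "k \<in> I" for k using comb[OF that, of "\<lambda>j. u (e j)"] by simp
    then show False using u(1) by auto
  qed
  moreover have "L \<subseteq> vec.span (e ` I)"
  proof
    fix x assume x: "x \<in> L"
    let ?y = "x - (\<Sum>j\<in>I. x $ j *s e j)"
    have "?y \<in> L"
      using L x e(1) by (intro vec.subspace_diff vec.subspace_sum vec.subspace_scale) auto
    moreover have "\<forall>k\<in>I. ?y $ k = 0" using comb[of _ "\<lambda>j. x $ j"] by simp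
    ultimately have "?y = 0" using I by (auto simp: vanishing_free_def)
    then have "x = (\<Sum>j\<in>I. x $ j *s e j)" by simp
    also have "\<dots> \<in> vec.span (e ` I)"
      by (intro vec.span_sum vec.span_scale vec.span_base) auto
    finally show "x \<in> vec.span (e ` I)" .
  qed
  ultimately have "vec.dim L = card (e ` I)"
    using e(1) by (intro vec.dim_unique) auto
  then show ?thesis by (simp add: card_image[OF inj])
qed

lemma vanishing_free_subset:
  fixes L :: "('k::field ^ 'n::finite) set"
  assumes "vec.subspace L" "vanishing_free L I"
  obtains J where "J \<subseteq> I" "vanishing_free L J" "card J = vec.dim L"
proof -
  let ?F = "{J. J \<subseteq> I \<and> vanishing_free L J}"
  have "finite ?F" "?F \<noteq> {}" using assms by auto
  from finite_has_minimal[OF this] obtain J where JF: "J \<in> ?F"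
    and min: "\<forall>K\<in>?F. K \<subseteq> J \<longrightarrow> J = K" by (elim bexE)
  then have J: "J \<subseteq> I" "vanishing_free L J" by auto
  have "\<not> vanishing_free L (J - {j})" if "j \<in> J" for j
  proof
    assume "vanishing_free L (J - {j})"
    then have "J - {j} \<in> ?F" using J(1) by auto
    then have "J = J - {j}" using min by auto
    then show False using that by auto
  qed
  then have "card J = vec.dim L" using card_minimal_vanishing_free[OF assms(1) J(2)] by blast
  then show thesis using that J by blast
qed

text \<open>The kernel of the transposed minor matrix consists of the coefficient vectors, in the
  ordered basis, of the vectors of \<open>L\<close> that vanish on \<open>I\<close>.\<close>

lemma plucker_eq_0_iff:
  fixes L :: "('k::field ^ 'n::{finite,linorder}) set"
  assumes L: "L \<in> grassmannian d" and I: "card I = d"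
  shows "plucker d L I = 0 \<longleftrightarrow> \<not> vanishing_free L I"
proof -
  let ?bs = "ordered_basis L" and ?js = "sorted_list_of_set I"
  let ?M = "mat d d (\<lambda>(a, b). (?bs ! a) $ (?js ! b))"
  note bs = ordered_basis[OF L]
  have js: "length ?js = d" "set ?js = I" using I by auto
  have bij: "bij_betw ((!) ?bs) {0..<d} (set ?bs)"
    using bij_betw_nth[OF bs(3), of "{..<d}" "set ?bs"] bs(4) by (simp add: lessThan_atLeast0)
  have reindex: "(\<Sum>a\<in>{0..<d}. u (?bs ! a) *s (?bs ! a)) = (\<Sum>v\<in>set ?bs. u v *s v)" for u
    using sum.reindex_bij_betw[OF bij, of "\<lambda>v. u v *s v"] .
  have prod: "vec_index (?M\<^sup>T *\<^sub>v v) b = (\<Sum>a\<in>{0..<d}. vec_index v a *s (?bs ! a)) $ (?js ! b)"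
    if "v \<in> carrier_vec d" "b < d" for v b
    using that by (auto simp: scalar_prod_def sum_component mult.commute intro!: sum.cong)
  have "plucker d L I = 0 \<longleftrightarrow> Determinant.det ?M\<^sup>T = 0"
    by (simp add: plucker_def minor_def det_transpose[OF mat_carrier])
  also have "\<dots> \<longleftrightarrow> (\<exists>v. v \<in> carrier_vec d \<and> v \<noteq> 0\<^sub>v d \<and> ?M\<^sup>T *\<^sub>v v = 0\<^sub>v d)"
    by (rule det_0_iff_vec_prod_zero) simp
  also have "\<dots> \<longleftrightarrow> \<not> vanishing_free L I"
  proof
    assume "\<exists>v. v \<in> carrier_vec d \<and> v \<noteq> 0\<^sub>v d \<and> ?M\<^sup>T *\<^sub>v v = 0\<^sub>v d"
    then obtain v where v: "v \<in> carrier_vec d" "v \<noteq> 0\<^sub>v d" "?M\<^sup>T *\<^sub>v v = 0\<^sub>v d" by blast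
    define x where "x = (\<Sum>a\<in>{0..<d}. vec_index v a *s (?bs ! a))"
    have "x $ (?js ! b) = 0" if "b < d" for b
      using prod[OF v(1) that] v(3) that by (simp add: x_def)
    then have "\<forall>j\<in>I. x $ j = 0" using js by (metis in_set_conv_nth)
    moreover have "x \<in> L"
    proof -
      have "?bs ! a \<in> L" if "a < d" for a
        using bs(2,4) that by (metis nth_mem vec.span_base)
      then show ?thesis
        unfolding x_def using L by (auto simp: grassmannian_def intro!: vec.subspace_sum vec.subspace_scale)
    qed
    moreover have "x \<noteq> 0"
    proof
      assume "x = 0"
      \<comment> \<open>Turns coefficients indexed by positions into coefficients indexed by basis
        vectors, as linear independence is stated for a set.\<close>
      define u where "u y = vec_index v (inv_into {0..<d} ((!) ?bs) y)" for y
      have u: "u (?bs ! a) = vec_index v a" if "a < d" for a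
        using bij that by (simp add: u_def bij_betw_def)
      have "(\<Sum>y\<in>set ?bs. u y *s y) = 0"
        unfolding reindex[symmetric] using \<open>x = 0\<close> u by (simp add: x_def)
      then have "\<forall>y\<in>set ?bs. u y = 0" using bs(1) by (auto simp: vec.dependent_finite)
      then have "vec_index v a = 0" if "a < d" for a using u[OF that] that bs(4) by (metis nth_mem)
      then have "v = 0\<^sub>v d" using v(1) by (intro eq_vecI) auto
      then show False using v(2) by simp
    qed
    ultimately show "\<not> vanishing_free L I" by (auto simp: vanishing_free_def)
  next
    assume "\<not> vanishing_free L I"
    then obtain x where x: "x \<in> L" "\<forall>j\<in>I. x $ j = 0" "x \<noteq> 0" by (auto simp: vanishing_free_def)
    obtain u where u: "x = (\<Sum>v\<in>set ?bs. u v *s v)"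
      using x(1) bs(2) by (force simp: vec.span_finite)
    define v where "v = Matrix.vec d (\<lambda>a. u (?bs ! a))"
    have x_eq: "(\<Sum>a\<in>{0..<d}. vec_index v a *s (?bs ! a)) = x"
      unfolding u reindex[symmetric] by (simp add: v_def)
    have v: "v \<in> carrier_vec d" by (simp add: v_def)
    have "v \<noteq> 0\<^sub>v d"
    proof
      assume "v = 0\<^sub>v d"
      then have "x = 0" unfolding x_eq[symmetric] by simp
      then show False using x(3) by simp
    qed
    moreover have "?M\<^sup>T *\<^sub>v v = 0\<^sub>v d"
    proof (rule eq_vecI)
      fix b assume "b < dim_vec (0\<^sub>v d)"
      then have b: "b < d" by simp
      then have "?js ! b \<in> I" using js by (metis nth_mem)
      then show "vec_index (?M\<^sup>T *\<^sub>v v) b = vec_index (0\<^sub>v d) b"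
        using prod[OF v b] x(2) b by (simp add: x_eq)
    qed simp
    ultimately show "\<exists>v. v \<in> carrier_vec d \<and> v \<noteq> 0\<^sub>v d \<and> ?M\<^sup>T *\<^sub>v v = 0\<^sub>v d" using v by blast
  qed
  finally show ?thesis .
qed

lemma matroid_bases_iff:
  assumes "L \<in> grassmannian d"
  shows "I \<in> matroid_bases d L \<longleftrightarrow> card I = d \<and> vanishing_free L I"
  using plucker_eq_0_iff[OF assms] by (auto simp: matroid_bases_def)

lemma matroid_bases_nonempty:
  assumes "L \<in> grassmannian d"
  shows "matroid_bases d L \<noteq> {}"
proof -
  have "vanishing_free L UNIV" by (auto simp: vanishing_free_def Finite_Cartesian_Product.vec_eq_iff)
  then obtain J where "vanishing_free L J" "card J = d"
    using vanishing_free_subset[of L UNIV] assms by (auto simp: grassmannian_def)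
  then show ?thesis using matroid_bases_iff[OF assms] by blast
qed

text \<open>By cardinality \<open>I - {x}\<close> is too small, so a nonzero \<open>v\<close> in
  \<open>L\<close> vanishes on it. Since \<open>J\<close> detects \<open>v\<close>, some
  \<open>y\<close> in \<open>J\<close> has \<open>v $ y \<noteq> 0\<close>, and this is the element
  to insert.\<close>

lemma matroid_bases_exchange:
  fixes L :: "('k::field ^ 'n::{finite,linorder}) set"
  assumes L: "L \<in> grassmannian d" and I: "I \<in> matroid_bases d L" and J: "J \<in> matroid_bases d L"
    and x: "x \<in> I - J"
  obtains y where "y \<in> J - I" "insert y (I - {x}) \<in> matroid_bases d L"
proof -
  have sub: "vec.subspace L" and dim: "vec.dim L = d" using L by (auto simp: grassmannian_def)
  have If: "card I = d" "vanishing_free L I" and Jf: "vanishing_free L J"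
    using I J matroid_bases_iff[OF L] by blast+
  have "\<not> vanishing_free L (I - {x})"
  proof
    assume "vanishing_free L (I - {x})"
    then obtain K where "K \<subseteq> I - {x}" "card K = d"
      using vanishing_free_subset[OF sub] dim by metis
    moreover have "card (I - {x}) < card I" using x by (intro card_Diff1_less) auto
    ultimately show False using If(1) card_mono[of "I - {x}" K] by simp
  qed
  then obtain v where v: "v \<in> L" "\<forall>k\<in>I - {x}. v $ k = 0" "v \<noteq> 0"
    by (auto simp: vanishing_free_def)
  then obtain y where y: "y \<in> J" "v $ y \<noteq> 0" using Jf by (auto simp: vanishing_free_def)
  have yI: "y \<notin> I" using v(2) x y by auto
  have "v $ x \<noteq> 0" using If(2) v by (auto simp: vanishing_free_def)
  have "vanishing_free L (insert y (I - {x}))"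
    unfolding vanishing_free_def
  proof (intro ballI impI)
    fix w assume w: "w \<in> L" "\<forall>k\<in>insert y (I - {x}). w $ k = 0"
    \<comment> \<open>Eliminates coordinate \<open>x\<close>, so \<open>?z\<close> vanishes on all
      of \<open>I\<close> and is zero; its coordinate \<open>y\<close> then gives
      \<open>w $ x = 0\<close>.\<close>
    let ?z = "v $ x *s w - w $ x *s v"
    have "?z \<in> L" using sub v w by (intro vec.subspace_diff vec.subspace_scale) auto
    moreover have "?z $ k = 0" if "k \<in> I" for k
      using that v(2) w(2) by (cases "k = x") auto
    ultimately have "?z = 0" using If(2) by (auto simp: vanishing_free_def)
    then have "?z $ y = 0" by simp
    then have "w $ x = 0" using w(2) y(2) by simp
    then have "\<forall>k\<in>I. w $ k = 0" using w(2) by auto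
    then show "w = 0" using If(2) w(1) by (auto simp: vanishing_free_def)
  qed
  moreover have "card (insert y (I - {x})) = d"
    using yI x If(1) card_Suc_Diff1[of I x] by simp
  ultimately show thesis using that y yI matroid_bases_iff[OF L] by blast
qed

section \<open>Projection to the blocks\<close>


lemma linear_block_sum: "linear (block_sum r)"
  unfolding block_sum_def
  by (rule linearI) (simp_all add: algebra_simps sum.distrib scaleR_sum_right)

lemma block_sum_axis: "block_sum r (axis j 1) = axis (block r j) 1"
proof -
  have "block_sum r (axis j 1) = (\<Sum>l\<in>UNIV. if l = j then axis (block r j) 1 else 0)"
    unfolding block_sum_def by (rule sum.cong) (auto simp: axis_def)
  then show ?thesis by simp
qed

lemma block_sum_root: "block_sum r (a + t *\<^sub>R (axis l 1 - axis k 1))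
    = block_sum r a + t *\<^sub>R (axis (block r l) 1 - axis (block r k) 1)"
  by (simp add: linear_add[OF linear_block_sum] linear_scale[OF linear_block_sum]
      linear_diff[OF linear_block_sum] block_sum_axis)

lemma block_sum_exchange: "block_sum r (a - axis x 1 + axis y 1)
    = block_sum r a - axis (block r x) 1 + axis (block r y) 1"
  by (simp add: linear_add[OF linear_block_sum] linear_diff[OF linear_block_sum] block_sum_axis)

lemma block_sum_nth: "block_sum r a $ i = (\<Sum>j | block r j = i. a $ j)"
proof -
  have "block_sum r a $ i = (\<Sum>j\<in>UNIV. if block r j = i then a $ j else 0)"
    unfolding block_sum_def sum_component by (rule sum.cong) (auto simp: axis_def)
  then show ?thesis by (simp add: sum.If_cases)
qed

lemma block_sum_indicator_vec_nth:
  "block_sum r (indicator_vec I) $ i = real (card {j\<in>I. block r j = i})"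
  using weight_nth[of r I i] by (simp add: weight_def)

lemma sum_block_sum: "(\<Sum>i\<in>UNIV. block_sum r a $ i) = (\<Sum>j\<in>UNIV. a $ j)"
  unfolding block_sum_nth using sum.group[of UNIV UNIV "block r" "vec_nth a"] by simp

section \<open>Lattice points of the projected hypersimplex\<close>

text \<open>If the blocks have sizes \<open>r i\<close>, these are exactly the images of the
  vertices of the hypersimplex, by \<open>fibre_sum_in_lattice_box\<close> and
  \<open>lattice_box_realize\<close>.\<close>

definition lattice_box :: "('m::finite \<Rightarrow> nat) \<Rightarrow> nat \<Rightarrow> (real ^ 'm) set" where
  "lattice_box r d = {v. (\<forall>i. v $ i \<in> \<nat> \<and> v $ i \<le> real (r i)) \<and> (\<Sum>i\<in>UNIV. v $ i) = real d}"

lemma discrete_polymatroid_subset: "discrete_polymatroid r d B \<Longrightarrow> B \<subseteq> lattice_box r d"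
  unfolding discrete_polymatroid_def lattice_box_def by blast

context
  fixes r :: "'m::{finite,linorder} \<Rightarrow> nat" and d :: nat
  assumes n: "CARD('n::{finite,linorder}) = (\<Sum>i\<in>UNIV. r i)"
begin

abbreviation (input) fibre_sum :: "real ^ 'n::{finite,linorder} \<Rightarrow> real ^ 'm::{finite,linorder}" where "fibre_sum \<equiv> block_sum r"

lemma fibre_sum_in_lattice_box:
  assumes "card I = d" shows "fibre_sum (indicator_vec I) \<in> lattice_box r d"
proof -
  have "card {j\<in>I. block r j = i} \<le> r i" for i
    unfolding card_block[OF n, of i, symmetric] by (intro card_mono) auto
  moreover have "(\<Sum>i\<in>UNIV. fibre_sum (indicator_vec I) $ i) = real d"
    unfolding sum_block_sum sum_indicator_vec using assms by simp
  ultimately show ?thesis by (simp add: lattice_box_def block_sum_indicator_vec_nth)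
qed

text \<open>Choose \<open>w $ i\<close> elements from block \<open>i\<close>, which has
  \<open>r i\<close> of them.\<close>

lemma lattice_box_realize:
  assumes w: "w \<in> lattice_box r d"
  obtains I :: "'n set" where "card I = d" "fibre_sum (indicator_vec I) = w"
proof -
  have "\<exists>A \<subseteq> {j :: 'n. block r j = i}. real (card A) = w $ i" for i
  proof -
    obtain k where k: "w $ i = real k" "k \<le> card {j :: 'n. block r j = i}"
      using w card_block[OF n, of i] unfolding lattice_box_def
      by (metis (mono_tags, lifting) Nats_cases mem_Collect_eq of_nat_le_iff)
    then show ?thesis using obtain_subset_with_card_n[OF k(2)] by metis
  qed
  then obtain A :: "'m \<Rightarrow> 'n set" where A: "\<And>i. A i \<subseteq> {j. block r j = i}" "\<And>i. real (card (A i)) = w $ i"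
    by metis
  define I where "I = (\<Union>i. A i)"
  have "{j\<in>I. block r j = i} = A i" for i using A(1) by (auto simp: I_def)
  then have Iw: "fibre_sum (indicator_vec I) = w"
    by (simp add: Finite_Cartesian_Product.vec_eq_iff block_sum_indicator_vec_nth A(2))
  then have "real (card I) = (\<Sum>i\<in>UNIV. w $ i)"
    using sum_block_sum[of r "indicator_vec I"] by (simp add: sum_indicator_vec)
  then have "card I = d" using w by (simp add: lattice_box_def)
  then show thesis using that Iw by blast
qed

text \<open>Realise \<open>w\<close> by a set \<open>I\<close>. As the second end point is in the
  box too, \<open>I\<close> meets block \<open>i\<close> and misses an element of block
  \<open>j\<close>; swapping these two elements is an edge of the hypersimplex.\<close>

lemma unit_segment_is_edge_image:
  assumes w: "w \<in> lattice_box r d" and w': "w - axis i 1 + axis j 1 \<in> lattice_box r d" and ij: "i \<noteq> j"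
  obtains F where "F edge_of hypersimplex d" "fibre_sum ` F = closed_segment w (w - axis i 1 + axis j 1)"
proof -
  obtain I :: "'n set" where I: "card I = d" "fibre_sum (indicator_vec I) = w"
    using lattice_box_realize[OF w] by blast
  have wi: "w $ k = real (card {j\<in>I. block r j = k})" for k
    unfolding I(2)[symmetric] block_sum_indicator_vec_nth by simp
  have "(w - axis i 1 + axis j 1) $ i \<in> \<nat>" using w' unfolding lattice_box_def by blast
  then have "w $ i - 1 \<in> \<nat>" using ij by (simp add: axis_def)
  then have "w $ i \<noteq> 0" by (auto elim!: Nats_cases)
  then have "{k\<in>I. block r k = i} \<noteq> {}" using wi by auto
  then obtain x where x: "x \<in> I" "block r x = i" by blast
  have "(w - axis i 1 + axis j 1) $ j \<le> real (r j)" using w' unfolding lattice_box_def by blast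
  then have "w $ j < real (r j)" using ij by (simp add: axis_def)
  then have "card {k\<in>I. block r k = j} < card {k :: 'n. block r k = j}"
    using wi card_block[OF n, of j] by simp
  then have "\<not> {k. block r k = j} \<subseteq> {k\<in>I. block r k = j}"
    using card_mono[of "{k\<in>I. block r k = j}" "{k :: 'n. block r k = j}"] by auto
  then obtain y where y: "y \<notin> I" "block r y = j" by blast
  let ?F = "closed_segment (indicator_vec I) (indicator_vec I - axis x 1 + axis y 1)"
  have "fibre_sum (indicator_vec I - axis x 1 + axis y 1) = w - axis i 1 + axis j 1"
    using I(2) x(2) y(2) by (simp add: block_sum_exchange)
  then have "fibre_sum ` ?F = closed_segment w (w - axis i 1 + axis j 1)"
    unfolding closed_segment_linear_image[OF linear_block_sum, symmetric] I(2) by simp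
  then show thesis using that hypersimplex_edge[OF I(1) x(1) y(1)] by blast
qed

lemma fibre_sum_hypersimplex:
  assumes "v \<in> fibre_sum ` hypersimplex d"
  shows "v $ i \<le> real (r i)" "(\<Sum>i\<in>UNIV. v $ i) = real d"
proof -
  obtain a where a: "a \<in> hypersimplex d" "v = fibre_sum a" using assms by blast
  have "v $ i \<le> (\<Sum>j\<in>{j :: 'n. block r j = i}. 1)" for i
    unfolding a(2) block_sum_nth using a(1) by (intro sum_mono) (auto simp: hypersimplex_def)
  from this[of i] show "v $ i \<le> real (r i)" using card_block[OF n, of i] by simp
  show "(\<Sum>i\<in>UNIV. v $ i) = real d"
    using a by (simp add: sum_block_sum hypersimplex_def)
qed

section \<open>From discrete polymatroids to subpolytopes\<close>

text \<open>An edge of the hull is parallel to a root and has lattice end points, so it splits into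
  unit segments, each the image of an edge of the hypersimplex.\<close>

lemma hull_is_subpolytope_of_image:
  assumes B: "discrete_polymatroid r d B"
  shows "subpolytope_of_image fibre_sum (hypersimplex d) (convex hull B)"
proof -
  let ?Q = "hypersimplex d :: (real ^ 'n::{finite,linorder}) set"
  have sub: "B \<subseteq> lattice_box r d" by (rule discrete_polymatroid_subset[OF B])
  have P: "polytope (convex hull B)" using finite_polymatroid[OF B] polytope_def by blast
  have vertex: "v \<in> fibre_sum ` {w. w extreme_point_of ?Q}" if "v \<in> B" for v
  proof -
    obtain I :: "'n set" where "card I = d" "fibre_sum (indicator_vec I) = v"
      using lattice_box_realize sub \<open>v \<in> B\<close> by blast
    then show ?thesis by (auto simp: extreme_point_of_hypersimplex_iff)
  qed
  then have "B \<subseteq> fibre_sum ` ?Q" unfolding extreme_point_of_def by blast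
  then have hull: "convex hull B \<subseteq> fibre_sum ` ?Q"
    by (intro hull_minimal convex_linear_image linear_block_sum convex_hypersimplex)
  have edge: "\<exists>\<E>. \<E> \<subseteq> {fibre_sum ` F |F. F edge_of ?Q} \<and> E = \<Union>\<E>"
    if E: "E edge_of convex hull B" for E
  proof -
    obtain x y where xy: "E = closed_segment x y"
      "x extreme_point_of convex hull B" "y extreme_point_of convex hull B"
      using edge_of_polytope_segment[OF P E] by blast
    have xB: "x \<in> lattice_box r d" "y \<in> lattice_box r d"
      using xy extreme_point_of_convex_hull sub by blast+
    obtain i j t where ij: "i \<noteq> j" "t > 0" "y = x + t *\<^sub>R (axis j 1 - axis i 1)" (is "_ = _ + _ *\<^sub>R ?x")
    proof -
      obtain a i j where a: "i \<noteq> j" "a \<in> closed_segment x y" "a - axis i 1 + axis j 1 \<in> closed_segment x y"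
        using polymatroid_edge_root[OF B E] unfolding xy(1) by metis
      obtain k l t where "{k, l} = {i, j}" "t > 0" "y = x + t *\<^sub>R (axis l 1 - axis k 1)"
        by (rule segment_root_direction[OF a])
      then show thesis using that[of k l t] a(1) by (auto simp: doubleton_eq_iff)
    qed
    have box_nth: "x $ h \<in> \<nat>" "y $ h \<in> \<nat>" "x $ h \<le> real (r h)" "y $ h \<le> real (r h)" for h
      using xB unfolding lattice_box_def by blast+
    obtain a where a: "y $ i = real a" using box_nth(2)[of i] by (auto elim: Nats_cases)
    obtain b where b: "x $ j = real b" using box_nth(1)[of j] by (auto elim: Nats_cases)
    obtain c where c: "y $ j = real c" using box_nth(2)[of j] by (auto elim: Nats_cases)
    have yi: "y $ i = x $ i - t" and yj: "y $ j = x $ j + t"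
      using ij by (auto simp: axis_def)
    \<comment> \<open>The number of unit segments: the edge length \<open>t\<close> is a difference
      of two natural coordinates.\<close>
    define k where "k = c - b"
    have tk: "t = real k" and "k > 0" using yj ij(2) b c by (auto simp: k_def)
    \<comment> \<open>Only coordinates \<open>i\<close> and \<open>j\<close> vary along the edge,
      and the upper bounds there hold at \<open>x\<close> and \<open>y\<close> respectively.\<close>
    have box: "x + real l *\<^sub>R ?x \<in> lattice_box r d" if "l \<le> k" for l
    proof -
      let ?w = "x + real l *\<^sub>R ?x"
      have wi: "?w $ i = real (a + (k - l))" "?w $ i \<le> x $ i"
        using yi a tk that ij(1) by (simp_all add: axis_def of_nat_diff)
      have wj: "?w $ j = real (b + l)" "?w $ j \<le> y $ j"
        using b yj tk that ij(1) by (simp_all add: axis_def)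
      have "?w $ h \<in> \<nat> \<and> ?w $ h \<le> real (r h)" for h
      proof -
        consider "h = i" | "h = j" | "h \<noteq> i" "h \<noteq> j" by blast
        then show ?thesis
        proof cases
          case 1
          then show ?thesis using wi box_nth(3)[of i] by (metis of_nat_in_Nats order_trans)
        next
          case 2
          then show ?thesis using wj box_nth(4)[of j] by (metis of_nat_in_Nats order_trans)
        next
          case 3
          then have "?w $ h = x $ h" by (simp add: axis_def)
          then show ?thesis using box_nth(1,3)[of h] by metis
        qed
      qed
      moreover have "indicator_vec UNIV \<bullet> ?w = indicator_vec UNIV \<bullet> x"
        by (simp add: inner_add_right inner_indicator_vec_root)
      then have "(\<Sum>h\<in>UNIV. ?w $ h) = real d"
        unfolding inner_indicator_vec using xB(1) by (simp add: lattice_box_def)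
      ultimately show ?thesis unfolding lattice_box_def by blast
    qed
    have inE: "x + s *\<^sub>R ?x \<in> E" if "0 \<le> s" "s \<le> t" for s
      using convex_shorter_step[of E x t ?x s] that ij(3) xy(1) by simp
    have "\<exists>F. F edge_of ?Q \<and> fibre_sum ` F \<subseteq> E \<and> p \<in> fibre_sum ` F" if p: "p \<in> E" for p
    proof -
      obtain u where u: "0 \<le> u" "u \<le> 1" "p = x + u *\<^sub>R (y - x)"
        using p unfolding xy(1) by (auto simp: closed_segment_def algebra_simps)
      define s where "s = u * t"
      have s: "0 \<le> s" "s \<le> real k" "p = x + s *\<^sub>R ?x"
        using u ij(2,3) tk by (auto simp: s_def mult_left_le_one_le)
      \<comment> \<open>The unit segment containing \<open>p\<close>; the cap \<open>k - 1\<close>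
        serves the far end \<open>s = k\<close>, where the floor would select a segment outside
        \<open>E\<close>.\<close>
      define l where "l = min (nat \<lfloor>s\<rfloor>) (k - 1)"
      have l: "real l \<le> s" "s \<le> real l + 1" "Suc l \<le> k"
      proof -
        have "real (nat \<lfloor>s\<rfloor>) \<le> s" "s \<le> real (nat \<lfloor>s\<rfloor>) + 1" using s(1) by linarith+
        moreover have "real (k - 1) = real k - 1" using \<open>k > 0\<close> by (simp add: of_nat_diff)
        ultimately show "real l \<le> s" "s \<le> real l + 1" "Suc l \<le> k"
          using s(2) \<open>k > 0\<close> unfolding l_def min_def by auto
      qed
      let ?w = "x + real l *\<^sub>R ?x"
      have w': "?w - axis i 1 + axis j 1 = x + real (Suc l) *\<^sub>R ?x" by (simp add: algebra_simps)
      have "?w \<in> lattice_box r d" "?w - axis i 1 + axis j 1 \<in> lattice_box r d"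
        unfolding w' using box[of l] box[of "Suc l"] l(3) by simp_all
      from unit_segment_is_edge_image[OF this ij(1)]
      obtain F where F: "F edge_of ?Q" "fibre_sum ` F = closed_segment ?w (x + real (Suc l) *\<^sub>R ?x)"
        unfolding w' by blast
      have "?w \<in> E" "x + real (Suc l) *\<^sub>R ?x \<in> E" using inE l tk by auto
      then have "closed_segment ?w (x + real (Suc l) *\<^sub>R ?x) \<subseteq> E"
        unfolding xy(1) by (intro closed_segment_subset) auto
      moreover have "p = (1 - (s - l)) *\<^sub>R ?w + (s - l) *\<^sub>R (x + real (Suc l) *\<^sub>R ?x)"
        unfolding s(3) by (simp add: algebra_simps)
      then have "p \<in> closed_segment ?w (x + real (Suc l) *\<^sub>R ?x)"
        using l(1,2) unfolding closed_segment_def by (auto intro!: exI[of _ "s - real l"])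
      ultimately show ?thesis using F(1) unfolding F(2)[symmetric] by (intro exI[of _ F] conjI)
    qed
    note cover = this
    define \<E> where "\<E> = {X. (\<exists>F. F edge_of ?Q \<and> X = fibre_sum ` F) \<and> X \<subseteq> E}"
    have "E \<subseteq> \<Union>\<E>"
    proof
      fix p assume "p \<in> E"
      then obtain F where F: "F edge_of ?Q" "fibre_sum ` F \<subseteq> E" "p \<in> fibre_sum ` F"
        using cover by metis
      then have "fibre_sum ` F \<in> \<E>" unfolding \<E>_def mem_Collect_eq by metis
      then show "p \<in> \<Union>\<E>" using F(3) by (rule UnionI)
    qed
    moreover have "\<Union>\<E> \<subseteq> E" unfolding \<E>_def by (rule Union_least) simp
    moreover have "\<E> \<subseteq> {fibre_sum ` F |F. F edge_of ?Q}"
      unfolding \<E>_def by (rule Collect_mono) metis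
    ultimately show ?thesis by (intro exI[of _ \<E>] conjI equalityI)
  qed
  have "convex hull B \<noteq> {}" using B by (simp add: discrete_polymatroid_def)
  with P hull show ?thesis
    unfolding subpolytope_of_image_def
    by (intro conjI allI impI edge vertex) (auto dest: extreme_point_of_convex_hull)
qed

section \<open>From subpolytopes to discrete polymatroids\<close>

text \<open>An edge of the hypersimplex contains two points differing by a root. If the root joins
  different blocks, its image is a root within \<open>E\<close>; otherwise the edge is mapped to a
  point. Points alone cannot make up \<open>E\<close>, since there are only finitely many
  edges.\<close>

lemma subpolytope_edge_root:
  assumes d: "d \<le> CARD('n)" and P: "subpolytope_of_image fibre_sum (hypersimplex d) P" and E: "E edge_of P"
  shows "\<exists>a i j. i \<noteq> j \<and> a \<in> E \<and> a - axis i 1 + axis j 1 \<in> E"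
proof (rule ccontr)
  assume not_root: "\<not> ?thesis"
  let ?Q = "hypersimplex d :: (real ^ 'n::{finite,linorder}) set"
  have poly: "polytope P" using P by (simp add: subpolytope_of_image_def)
  obtain \<E> where \<E>: "\<E> \<subseteq> {fibre_sum ` F |F. F edge_of ?Q}" "E = \<Union>\<E>"
    using P E unfolding subpolytope_of_image_def by blast
  have fin: "finite (fibre_sum ` F)" if F: "F edge_of ?Q" "fibre_sum ` F \<subseteq> E" for F
  proof -
    obtain a i j where a: "i \<noteq> j" "a \<in> F" "a - axis i 1 + axis j 1 \<in> F"
      using hypersimplex_edge_root[OF d F(1)] by blast
    have "fibre_sum a \<in> E" "fibre_sum (a - axis i 1 + axis j 1) \<in> E" using a F(2) by blast+
    then have ij: "block r i = block r j" using not_root unfolding block_sum_exchange by blast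
    obtain x y where xy: "F = closed_segment x y"
      using edge_of_polytope_segment[OF polytope_hypersimplex F(1)] by metis
    obtain k l t where kl: "{k, l} = {i, j}" "y = x + t *\<^sub>R (axis l 1 - axis k 1)"
      using segment_root_direction a unfolding xy by metis
    have "block r k = block r l" using kl(1) ij by (auto simp: doubleton_eq_iff)
    then have "fibre_sum y = fibre_sum x" unfolding kl(2) block_sum_root by simp
    then have "fibre_sum ` F = closed_segment (fibre_sum x) (fibre_sum x)"
      unfolding xy closed_segment_linear_image[OF linear_block_sum, symmetric] by simp
    then show ?thesis by simp
  qed
  have "finite E"
  proof -
    have "finite {F. F edge_of ?Q}"
      by (rule finite_subset[OF _ finite_polytope_faces[OF polytope_hypersimplex]]) (auto simp: edge_of_def)
    then have "finite {fibre_sum ` F |F. F edge_of ?Q}" by simp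
    then have "finite \<E>" using \<E>(1) finite_subset by blast
    moreover have "finite X" if X: "X \<in> \<E>" for X
    proof -
      obtain F where "X = fibre_sum ` F" "F edge_of ?Q" using \<E>(1) X by blast
      moreover from this have "fibre_sum ` F \<subseteq> E" using \<E>(2) X by blast
      ultimately show ?thesis using fin by blast
    qed
    ultimately show ?thesis unfolding \<E>(2) by blast
  qed
  moreover obtain x y where "E = closed_segment x y" "x \<noteq> y"
    using edge_of_polytope_segment[OF poly E] by metis
  ultimately show False by (simp add: finite_closed_segment)
qed

text \<open>The vertices are lattice points, being images of vertices, so the hull is all of
  \<open>P\<close>; the exchange property comes from \<open>root_polytope_exchange\<close>.\<close>

lemma subpolytope_is_hull:
  assumes d: "d \<le> CARD('n)" and P: "subpolytope_of_image fibre_sum (hypersimplex d) P"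
  defines "B \<equiv> {v \<in> P. \<forall>i. v $ i \<in> \<nat>}"
  shows "discrete_polymatroid r d B" "convex hull B = P"
proof -
  have poly: "polytope P" and ne: "P \<noteq> {}" and sub: "P \<subseteq> fibre_sum ` hypersimplex d"
    using P by (auto simp: subpolytope_of_image_def)
  have nat: "v $ i \<in> \<nat>" if v: "v extreme_point_of P" for v i
  proof -
    obtain w where "w extreme_point_of hypersimplex d" "v = fibre_sum w"
      using P v unfolding subpolytope_of_image_def by blast
    then show ?thesis by (auto simp: extreme_point_of_hypersimplex_iff block_sum_indicator_vec_nth)
  qed
  have P_hull: "P = convex hull {v. v extreme_point_of P}"
    using Krein_Milman_Minkowski poly polytope_imp_compact polytope_imp_convex by blast
  moreover have "{v. v extreme_point_of P} \<subseteq> B" using nat by (auto simp: B_def extreme_point_of_def)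
  ultimately have "P \<subseteq> convex hull B" using hull_mono by metis
  moreover have "convex hull B \<subseteq> P"
    using poly polytope_imp_convex by (intro hull_minimal) (auto simp: B_def)
  ultimately show hull: "convex hull B = P" by blast
  have "\<exists>j. u $ j < v $ j \<and> u - axis i 1 + axis j 1 \<in> B"
    if u: "u \<in> B" and v: "v \<in> B" and i: "v $ i < u $ i" for u v i
  proof -
    obtain j where j: "u $ j < v $ j" "u - axis i 1 + axis j 1 \<in> P"
      using root_polytope_exchange[OF poly subpolytope_edge_root[OF d P] nat, of u v i] u v i
      unfolding B_def by blast
    \<comment> \<open>The only coordinate that drops is \<open>i\<close>, and there \<open>u\<close>
      exceeds a natural number.\<close>
    have "(u - axis i 1 + axis j 1) $ k \<in> \<nat>" for k
    proof -
      obtain a b where ab: "u $ i = real a" "v $ i = real b"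
        using u v by (auto simp: B_def elim!: Nats_cases dest!: spec[of _ i])
      then have "u $ i - 1 = real (a - 1)" using i by (simp add: of_nat_diff)
      then have "u $ i - 1 \<in> \<nat>" by simp
      moreover have "u $ k \<in> \<nat>" using u by (simp add: B_def)
      ultimately show ?thesis by (auto simp: axis_def)
    qed
    then show ?thesis using j by (auto simp: B_def)
  qed
  moreover have "B \<noteq> {}" using hull ne by auto
  moreover have "v $ i \<le> real (r i)" "(\<Sum>i\<in>UNIV. v $ i) = real d" if "v \<in> B" for v i
    using fibre_sum_hypersimplex[of v] sub that by (auto simp: B_def)
  ultimately show "discrete_polymatroid r d B"
    unfolding discrete_polymatroid_def by (auto simp: B_def)
qed

text \<open>A single matroid exchange may end in a block in which \<open>u\<close> is not below \<open>v\<close>. The next exchange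
  then starts from that block; the process stops because \<open>I - J\<close> shrinks.\<close>

lemma represented_polymatroid_is_polymatroid:
  fixes L :: "('k::field ^ 'n::{finite,linorder}) set"
  assumes L: "L \<in> grassmannian d"
  shows "discrete_polymatroid r d (represented_polymatroid r d L)"
proof -
  let ?f = "\<lambda>I :: 'n set. block_sum r (indicator_vec I) :: real ^ 'm::{finite,linorder}"
  let ?B = "represented_polymatroid r d L"
  have "?B \<noteq> {}" using matroid_bases_nonempty[OF L] by (auto simp: represented_polymatroid_def)
  moreover have "?B \<subseteq> lattice_box r d"
    using fibre_sum_in_lattice_box by (auto simp: represented_polymatroid_def matroid_bases_def)
  moreover have "\<exists>j. u $ j < v $ j \<and> u - axis i 1 + axis j 1 \<in> ?B"
    if u: "u \<in> ?B" and v: "v \<in> ?B" and i: "v $ i < u $ i" for u v i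
  proof -
    obtain J where J: "J \<in> matroid_bases d L" "v = ?f J" using v by (auto simp: represented_polymatroid_def)
    \<comment> \<open>Generalised for induction: \<open>l\<close> is the block in which the current
      basis has a surplus over \<open>v\<close>. The start \<open>l = i\<close> is \<open>u\<close>
      itself.\<close>
    have *: "\<exists>j. u $ j < v $ j \<and> u - axis i 1 + axis j 1 \<in> ?B"
      if "I \<in> matroid_bases d L" "?f I = u - axis i 1 + axis l 1" "v $ l < ?f I $ l" for I l
      using that
    proof (induction "card (I - J)" arbitrary: I l rule: less_induct)
      case less
      have "card {j\<in>J. block r j = l} < card {j\<in>I. block r j = l}"
        using less.prems(3) by (simp add: J(2) block_sum_indicator_vec_nth)
      then have "\<not> {j\<in>I. block r j = l} \<subseteq> {j\<in>J. block r j = l}"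
        using card_mono[OF finite, of "{j\<in>I. block r j = l}" "{j\<in>J. block r j = l}"] by auto
      then obtain x where x: "x \<in> I - J" "block r x = l" by blast
      obtain y where y: "y \<in> J - I" "insert y (I - {x}) \<in> matroid_bases d L"
        using matroid_bases_exchange[OF L less.prems(1) J(1) x(1)] by blast
      let ?I = "insert y (I - {x})" and ?l = "block r y"
      have "?f ?I = ?f I - axis l 1 + axis ?l 1"
        using x y by (simp add: block_sum_exchange flip: indicator_vec_exchange)
      then have I': "?f ?I = u - axis i 1 + axis ?l 1" using less.prems(2) by simp
      show ?case
      proof (cases "u $ ?l < v $ ?l")
        case True
        moreover have "?f ?I \<in> ?B" using y(2) by (auto simp: represented_polymatroid_def)
        ultimately show ?thesis unfolding I' by blast
      next
        case False
        \<comment> \<open>The inserted element creates a surplus at \<open>?l\<close>; if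
          \<open>?l = i\<close>, it restores the original one.\<close>
        have "v $ ?l < ?f ?I $ ?l" unfolding I' using False i by (auto simp: axis_def)
        moreover have "card (?I - J) < card (I - J)"
          using x y by (intro psubset_card_mono) auto
        ultimately show ?thesis using less.hyps[OF _ y(2) I'] by blast
      qed
    qed
    obtain I where "I \<in> matroid_bases d L" "u = ?f I" using u by (auto simp: represented_polymatroid_def)
    then show ?thesis using *[of I i] i by simp
  qed
  ultimately show ?thesis unfolding discrete_polymatroid_def lattice_box_def by blast
qed

end

section \<open>The bijection and the representable case\<close>

theorem theorem1p1:
  fixes r :: "'m::{finite,linorder} \<Rightarrow> nat" and d :: nat
  assumes "\<forall>i. r i > 0"
    and "CARD('n::{finite,linorder}) = (\<Sum>i\<in>UNIV. r i)"
    and "1 \<le> d" and "d \<le> CARD('n)"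
  shows "bij_betw (\<lambda>B. convex hull B)
           {B. discrete_polymatroid r d B}
           {P. subpolytope_of_image (block_sum r :: real ^ 'n::{finite,linorder} \<Rightarrow> real ^ 'm::{finite,linorder}) (hypersimplex d) P}
       \<and> (\<lambda>B. convex hull B) `
           {B. discrete_polymatroid r d B \<and>
               (\<exists>L :: ('k::field ^ 'n::{finite,linorder}) set. L \<in> grassmannian d \<and> B = represented_polymatroid r d L)}
         = {orbit_closure_polytope r d L |L :: ('k ^ 'n::{finite,linorder}) set. L \<in> grassmannian d}"
proof (intro conjI)
  note n = assms(2) and d = assms(4)
  let ?\<B> = "{B. discrete_polymatroid r d B}"
  let ?\<P> = "{P. subpolytope_of_image (block_sum r :: real ^ 'n::{finite,linorder} \<Rightarrow> real ^ 'm::{finite,linorder}) (hypersimplex d) P}"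
  show "bij_betw (\<lambda>B. convex hull B) ?\<B> ?\<P>"
  \<comment> \<open>The inverse takes the lattice points of a polytope:
    \<open>polymatroid_hole_free\<close> recovers \<open>B\<close> from its hull, and
    \<open>subpolytope_is_hull\<close> recovers \<open>P\<close>.\<close>
  proof (rule bij_betwI[where g = "\<lambda>P. {v \<in> P. \<forall>i. v $ i \<in> \<nat>}"])
    show "(\<lambda>B. convex hull B) \<in> ?\<B> \<rightarrow> ?\<P>"
      using hull_is_subpolytope_of_image[OF n] by blast
    show "(\<lambda>P. {v \<in> P. \<forall>i. v $ i \<in> \<nat>}) \<in> ?\<P> \<rightarrow> ?\<B>"
      using subpolytope_is_hull(1)[OF n d] by blast
    fix B assume "B \<in> ?\<B>"
    then have "discrete_polymatroid r d B" by simp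
    then show "{v \<in> convex hull B. \<forall>i. v $ i \<in> \<nat>} = B"
      using polymatroid_hole_free polymatroid_nth(1) by (fastforce simp: hull_inc)
  next
    fix P assume "P \<in> ?\<P>"
    then show "convex hull {v \<in> P. \<forall>i. v $ i \<in> \<nat>} = P"
      using subpolytope_is_hull(2)[OF n d] by blast
  qed
  have hull: "orbit_closure_polytope r d L = convex hull (represented_polymatroid r d L)"
    for L :: "('k ^ 'n::{finite,linorder}) set"
    unfolding orbit_closure_polytope_def represented_polymatroid_def matroid_bases_def weight_def by simp
  \<comment> \<open>By \<open>hull\<close> both sides consist of the hulls of the represented sets,
    which are discrete polymatroids by
    \<open>represented_polymatroid_is_polymatroid\<close>.\<close>
  show "(\<lambda>B. convex hull B) `
      {B. discrete_polymatroid r d B \<and>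
        (\<exists>L :: ('k ^ 'n::{finite,linorder}) set. L \<in> grassmannian d \<and> B = represented_polymatroid r d L)}
    = {orbit_closure_polytope r d L |L :: ('k ^ 'n::{finite,linorder}) set. L \<in> grassmannian d}"
    unfolding hull using represented_polymatroid_is_polymatroid[OF n] by blast
qed

end
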